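(* Let $a\in(0,1)$. For any arclength-parameterized almost-Riemannian geodesic $\vec\gamma_t$ on $S^2$ with initial point $\vec\gamma_0\in\mathcal{S}$ and initial covector $p_0$, the cut time $t_{cut}$ satisfies the following bounds: 1. if $p_0\in C_1$: $t_{cut}\le 2K(k^2)/a$; 2. if $p_0\in C_2$: $t_{cut}\le 2kK(k^2)/a$; 3. if $p_0\in C_3$: $t_{cut}\le \pi/\sqrt{1-a^2}$; 4. if $p_0\in C_4$: $t_{cut}\le \pi$; 5. if $p_0\in C_5$: $t_{cut}\le \pi/\sqrt{1-a^2}$.
   Context: Fix $a\in(0,1)$. $e_1,e_2,e_3$ is the standard basis of $\mathbb{R}^3$ and $S^2\subset\mathbb{R}^3$ the unit sphere. The almost-Riemannian structure on $S^2$ has orthonormal frame $X_1(\vec\gamma)=\vec\gamma\times e_2$, $X_2(\vec\gamma)=\sqrt{1-a^2}\,\vec\gamma\times e_1$: admissible curves satisfy $\dot{\vec\gamma}=\vec\gamma\times\vec\omega$, $\vec\omega=u_2\sqrt{1-a^2}\,e_1+u_1e_2$, with length $\int_0^T\sqrt{u_1^2+u_2^2}\,dt$. The singular set is $\mathcal{S}=\{xe_1+ye_2+ze_3\in S^2: z=0\}$. Arclength-parameterized geodesics from $\vec\gamma_0=x_0e_1+y_0e_2+z_0e_3$ are the curves $\vec\gamma_t$ for which there is $p_t=(p_1,p_2,p_3)\in\mathbb{R}^3$ with $$\dot{\vec\gamma}=\vec\gamma\times(p_1e_2+p_2\sqrt{1-a^2}\,e_1),\qquad \dot p_1=p_3p_2,\quad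 \dot p_2=-p_3p_1,\quad \dot p_3=a^2p_1p_2,\qquad p_1^2+p_2^2=1,$$ and $p_2(0)x_0+\sqrt{1-a^2}\,p_1(0)y_0+p_3(0)z_0=0$. The initial covector is $p_0=(p_1(0),p_2(0),p_3(0))$. The cut time is the supremum of $t>0$ such that $\vec\gamma_s$, $s\in[0,t]$, has minimal length among admissible curves with the same endpoints. Regions: on $\{p_1^2+p_2^2=1\}$ write $p_1=\cos\psi$, $p_2=-\sin\psi$, $E=2p_3^2-a^2\cos2\psi$ (conserved). $C_1=\{E\in(-a^2,a^2)\}$, $C_2=\{E>a^2\}$, $C_3=\{E=a^2,\ p_3\ne0\}$, $C_4=\{E=-a^2\}$, $C_5=\{E=a^2,\ p_3=0\}$. The modulus $k\in(0,1)$ is given by $k^2=\frac{E+a^2}{2a^2}$ in $C_1$ and $k^2=\frac{2a^2}{E+a^2}$ in $C_2$. $K(k^2)=\int_0^{\pi/2}\frac{d\theta}{\sqrt{1-k^2\sin^2\theta}}$. *)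

theory Defs
  imports "HOL-Analysis.Analysis"
begin

unbundle cross3_syntax

section \<open>The almost-Riemannian structure on the sphere\<close>

definition X1 :: "real^3 \<Rightarrow> real^3" where
  "X1 q = q \<times> axis 2 1"

definition X2 :: "real \<Rightarrow> real^3 \<Rightarrow> real^3" where
  "X2 a q = sqrt (1 - a\<^sup>2) *\<^sub>R (q \<times> axis 1 1)"

definition omega :: "real \<Rightarrow> real \<Rightarrow> real \<Rightarrow> real^3" where
  "omega a v1 v2 = (v2 * sqrt (1 - a\<^sup>2)) *\<^sub>R axis 1 1 + v1 *\<^sub>R axis 2 1"

lemma cross_omega: "q \<times> omega a v1 v2 = v1 *\<^sub>R X1 q + v2 *\<^sub>R X2 a q"
  by (simp add: omega_def X1_def X2_def cross_add_right cross_mult_right add.commute)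

definition singular_set :: "(real^3) set" where
  "singular_set = {q \<in> sphere 0 1. q $ 3 = 0}"

text \<open>
  Admissible curves are the absolutely continuous curves with integrable controls that satisfy
  the control system almost everywhere; the differential equation is written in its equivalent
  integral form.
\<close>

definition admissible :: "real \<Rightarrow> real \<Rightarrow> (real \<Rightarrow> real^3) \<Rightarrow> (real \<Rightarrow> real) \<Rightarrow> (real \<Rightarrow> real) \<Rightarrow> bool"
  where
  "admissible a T \<gamma> u1 u2 \<longleftrightarrow>
     0 \<le> T \<and> \<gamma> ` {0..T} \<subseteq> sphere 0 1 \<and>
     u1 absolutely_integrable_on {0..T} \<and> u2 absolutely_integrable_on {0..T} \<and>
     (\<forall>t\<in>{0..T}. ((\<lambda>s. \<gamma> s \<times> omega a (u1 s) (u2 s)) has_integral (\<gamma> t - \<gamma> 0)) {0..t})"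

definition curve_length :: "real \<Rightarrow> (real \<Rightarrow> real) \<Rightarrow> (real \<Rightarrow> real) \<Rightarrow> real" where
  "curve_length T u1 u2 = integral {0..T} (\<lambda>t. sqrt ((u1 t)\<^sup>2 + (u2 t)\<^sup>2))"

definition length_minimizing ::
    "real \<Rightarrow> real \<Rightarrow> (real \<Rightarrow> real^3) \<Rightarrow> (real \<Rightarrow> real) \<Rightarrow> (real \<Rightarrow> real) \<Rightarrow> bool" where
  "length_minimizing a T \<gamma> u1 u2 \<longleftrightarrow>
     admissible a T \<gamma> u1 u2 \<and>
     (\<forall>T' \<eta> v1 v2. admissible a T' \<eta> v1 v2 \<and> \<eta> 0 = \<gamma> 0 \<and> \<eta> T' = \<gamma> T \<longrightarrow>
        curve_length T u1 u2 \<le> curve_length T' v1 v2)"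

section \<open>Geodesics and the cut time\<close>

definition arclength_geodesic :: "real \<Rightarrow> (real \<Rightarrow> real^3) \<Rightarrow> (real \<Rightarrow> real^3) \<Rightarrow> bool" where
  "arclength_geodesic a \<gamma> p \<longleftrightarrow>
     (\<forall>t\<ge>0. \<gamma> t \<in> sphere 0 1 \<and>
        (\<gamma> has_vector_derivative \<gamma> t \<times> omega a (p t $ 1) (p t $ 2)) (at t within {0..}) \<and>
        (p has_vector_derivative
           vector [p t $ 3 * p t $ 2, - (p t $ 3 * p t $ 1), a\<^sup>2 * p t $ 1 * p t $ 2])
          (at t within {0..}) \<and>
        (p t $ 1)\<^sup>2 + (p t $ 2)\<^sup>2 = 1) \<and>
     p 0 $ 2 * \<gamma> 0 $ 1 + sqrt (1 - a\<^sup>2) * p 0 $ 1 * \<gamma> 0 $ 2 + p 0 $ 3 * \<gamma> 0 $ 3 = 0"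

text \<open>The controls of a geodesic are the first two components of its covector.\<close>

definition cut_time :: "real \<Rightarrow> (real \<Rightarrow> real^3) \<Rightarrow> (real \<Rightarrow> real^3) \<Rightarrow> ereal" where
  "cut_time a \<gamma> p =
     Sup {ereal t | t. 0 < t \<and> length_minimizing a t \<gamma> (\<lambda>s. p s $ 1) (\<lambda>s. p s $ 2)}"

section \<open>Regions of initial covectors\<close>

definition covector_angle :: "real^3 \<Rightarrow> real" where
  "covector_angle p = (SOME \<psi>. p $ 1 = cos \<psi> \<and> p $ 2 = - sin \<psi>)"

definition energy :: "real \<Rightarrow> real^3 \<Rightarrow> real" where
  "energy a p = 2 * (p $ 3)\<^sup>2 - a\<^sup>2 * cos (2 * covector_angle p)"

definition cylinder :: "(real^3) set" where
  "cylinder = {p. (p $ 1)\<^sup>2 + (p $ 2)\<^sup>2 = 1}"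

definition C1 :: "real \<Rightarrow> (real^3) set" where
  "C1 a = {p \<in> cylinder. energy a p \<in> {- a\<^sup>2 <..< a\<^sup>2}}"

definition C2 :: "real \<Rightarrow> (real^3) set" where
  "C2 a = {p \<in> cylinder. energy a p > a\<^sup>2}"

definition C3 :: "real \<Rightarrow> (real^3) set" where
  "C3 a = {p \<in> cylinder. energy a p = a\<^sup>2 \<and> p $ 3 \<noteq> 0}"

definition C4 :: "real \<Rightarrow> (real^3) set" where
  "C4 a = {p \<in> cylinder. energy a p = - a\<^sup>2}"

definition C5 :: "real \<Rightarrow> (real^3) set" where
  "C5 a = {p \<in> cylinder. energy a p = a\<^sup>2 \<and> p $ 3 = 0}"

lemma covector_angle:
  assumes "p \<in> cylinder"
  shows "p $ 1 = cos (covector_angle p)" "p $ 2 = - sin (covector_angle p)"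
proof -
  have "(p $ 1)\<^sup>2 + (- (p $ 2))\<^sup>2 = 1"
    using assms by (simp add: cylinder_def)
  then obtain \<psi> where "p $ 1 = cos \<psi>" "- (p $ 2) = sin \<psi>"
    by (metis sincos_total_2pi)
  then have "\<exists>\<psi>. p $ 1 = cos \<psi> \<and> p $ 2 = - sin \<psi>"
    by (metis minus_minus)
  then have "p $ 1 = cos (covector_angle p) \<and> p $ 2 = - sin (covector_angle p)"
    unfolding covector_angle_def by (rule someI_ex)
  then show "p $ 1 = cos (covector_angle p)" "p $ 2 = - sin (covector_angle p)"
    by auto
qed

text \<open>The energy does not depend on the choice of the angle.\<close>

lemma energy_eq:
  assumes "p \<in> cylinder"
  shows "energy a p = 2 * (p $ 3)\<^sup>2 - a\<^sup>2 * ((p $ 1)\<^sup>2 - (p $ 2)\<^sup>2)"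
  using covector_angle[OF assms] by (simp add: energy_def cos_double)

text \<open>Only meaningful on \<^term>\<open>C1 a\<close> and \<^term>\<open>C2 a\<close>.\<close>

definition modulus :: "real \<Rightarrow> real^3 \<Rightarrow> real" where
  "modulus a p =
     (if p \<in> C1 a then sqrt ((energy a p + a\<^sup>2) / (2 * a\<^sup>2))
      else sqrt (2 * a\<^sup>2 / (energy a p + a\<^sup>2)))"

lemma modulus_C1:
  assumes "0 < a" "p \<in> C1 a"
  shows "modulus a p \<in> {0<..<1}" "(modulus a p)\<^sup>2 = (energy a p + a\<^sup>2) / (2 * a\<^sup>2)"
  using assms by (auto simp: modulus_def C1_def)

lemma modulus_C2:
  assumes "0 < a" "p \<in> C2 a"
  shows "modulus a p \<in> {0<..<1}" "(modulus a p)\<^sup>2 = 2 * a\<^sup>2 / (energy a p + a\<^sup>2)"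
proof -
  have "p \<notin> C1 a" and "energy a p > a\<^sup>2" and "a\<^sup>2 > 0"
    using assms by (auto simp: C1_def C2_def)
  then have "0 < energy a p + a\<^sup>2" "2 * a\<^sup>2 < energy a p + a\<^sup>2"
    by linarith+
  with \<open>a\<^sup>2 > 0\<close> have "0 < 2 * a\<^sup>2 / (energy a p + a\<^sup>2)" "2 * a\<^sup>2 / (energy a p + a\<^sup>2) < 1"
    by (simp_all only: divide_pos_pos divide_less_eq_1_pos zero_less_mult_iff zero_less_numeral simp_thms)
  with \<open>p \<notin> C1 a\<close> show "modulus a p \<in> {0<..<1}" "(modulus a p)\<^sup>2 = 2 * a\<^sup>2 / (energy a p + a\<^sup>2)"
    by (simp_all only: modulus_def if_False greaterThanLessThan_iff real_sqrt_gt_0_iff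
        real_sqrt_lt_1_iff real_sqrt_pow2 less_imp_le simp_thms)
qed

text \<open>
  The complete elliptic integral of the first kind as a function of the parameter
  \<open>m = k\<^sup>2\<close>, not of the modulus \<open>k\<close>.
\<close>

definition elliptic_K :: "real \<Rightarrow> real" where
  "elliptic_K m = integral {0..pi / 2} (\<lambda>\<theta>. 1 / sqrt (1 - m * (sin \<theta>)\<^sup>2))"

end

theory Submission
  imports Defs
begin

text \<open>
The bounds come from the reflection in the plane of the singular set. A geodesic that starts on
this equator and meets it again at a time \<open>\<tau> > 0\<close> has a mirror image with the same endpoints at
time \<open>\<tau>\<close>, because the reflection preserves admissible curves and their lengths. If the
geodesic were still minimizing after \<open>\<tau>\<close>, then so would be the curve that follows the mirror
image up to \<open>\<tau>\<close> and the geodesic afterwards. But a geodesic crosses the equator vertically, so that curve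
reverses its direction there, and a short rotation cuts off the cusp. Hence the cut time is at
most the first return time to the equator (\<open>not_minimizing_after_return\<close>).

It remains to bound the return time. Along a geodesic the height satisfies a scalar linear equation
\<open>\<gamma>3'' = - Q \<gamma>3\<close> with \<open>Q = p1\<^sup>2 + (1 - a\<^sup>2) p2\<^sup>2 + p3\<^sup>2\<close> (\<open>height_equation\<close>), so Sturm
comparison applies. In the regions \<open>C3\<close>, \<open>C4\<close> and \<open>C5\<close> a constant lower bound for \<open>Q\<close>
suffices. In \<open>C1\<close> and \<open>C2\<close> the component \<open>p2\<close> satisfies \<open>p2'' = - (Q - (1 - a\<^sup>2)) p2\<close>, which
is a weaker spring; a second solution of this equation is explicit, and it shows that solutions
vanishing at \<open>0\<close> vanish again within the half period of the covector
(\<open>height_zero_half_period\<close>). The covector moves like a pendulum, and its half period is the complete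
elliptic integral in the bounds (\<open>rotation_half_turn\<close>).
\<close>

section \<open>Sturm comparison\<close>

lemma first_zero:
  fixes f :: "real \<Rightarrow> real"
  assumes cont: "continuous_on {0..T} f" and der: "(f has_real_derivative d) (at 0 within {0..T})"
    and "d > 0" "f 0 = 0" "f T \<le> 0" "T > 0"
  obtains \<tau> where "0 < \<tau>" "\<tau> \<le> T" "f \<tau> = 0" "\<And>t. 0 < t \<Longrightarrow> t < \<tau> \<Longrightarrow> f t > 0"
proof -
  obtain e where e: "e > 0" "\<And>h. h > 0 \<Longrightarrow> h \<le> T \<Longrightarrow> h < e \<Longrightarrow> f h > 0"
    using has_real_derivative_pos_inc_right[OF der \<open>d > 0\<close>] \<open>f 0 = 0\<close> by auto
  define s where "s = min (e / 2) T"
  have s: "0 < s" "s \<le> T" "f s > 0" "s < e"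
    using e \<open>T > 0\<close> by (auto simp: s_def min_def)
  define Z where "Z = {t \<in> {s..T}. f t = 0}"
  have cont': "continuous_on {s..T} f"
    using cont s by (auto elim!: continuous_on_subset)
  have "closed Z"
    unfolding Z_def by (rule continuous_closed_preimage_constant[OF cont']) auto
  moreover have "bounded Z"
    by (rule bounded_subset[of "{s..T}"]) (auto simp: Z_def)
  ultimately have "compact Z"
    by (simp add: compact_eq_bounded_closed)
  moreover have "\<exists>x\<ge>s. x \<le> T \<and> f x = 0"
    by (rule IVT2') (use s \<open>f T \<le> 0\<close> cont' in auto)
  then have "Z \<noteq> {}"
    by (auto simp: Z_def)
  ultimately obtain \<tau> where \<tau>: "\<tau> \<in> Z" "\<And>t. t \<in> Z \<Longrightarrow> \<tau> \<le> t"
    using compact_attains_inf by metis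
  have "f t > 0" if "0 < t" "t < \<tau>" for t
  proof (cases "t \<le> s")
    case True
    then show ?thesis using e that s by auto
  next
    case False
    show ?thesis
    proof (rule ccontr)
      assume "\<not> f t > 0"
      then have "\<exists>x\<ge>s. x \<le> t \<and> f x = 0"
        using s False \<tau> that
        by (intro IVT2') (auto intro: continuous_on_subset[OF cont'] simp: Z_def)
      then show False
        using \<tau> that by (force simp: Z_def)
    qed
  qed
  then show thesis
    using that[of \<tau>] \<tau> s by (auto simp: Z_def)
qed

text \<open>
The larger restoring coefficient makes \<open>z\<close> vanish no later than \<open>G\<close>. By symmetry \<open>z\<close> may be
taken positive at first. If it stayed positive up to the first zero of \<open>G\<close>, the Wronskian
\<open>z' G - z G'\<close>, which starts at zero, could not increase until then, so the quotient \<open>G / z\<close>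
could not decrease; but it is positive at first and zero at the zero of \<open>G\<close>. The quotient also
settles the case \<open>q = Q\<close>, where the Wronskian is identically zero and its sign alone
contradicts nothing.
\<close>

lemma sturm_comparison_zero:
  fixes z z' G G' q Q :: "real \<Rightarrow> real"
  assumes "T > 0"
    and z: "\<And>t. t \<in> {0..T} \<Longrightarrow> (z has_real_derivative z' t) (at t within {0..T})"
    and z': "\<And>t. t \<in> {0..T} \<Longrightarrow> (z' has_real_derivative - Q t * z t) (at t within {0..T})"
    and G: "\<And>t. t \<in> {0..T} \<Longrightarrow> (G has_real_derivative G' t) (at t within {0..T})"
    and G': "\<And>t. t \<in> {0..T} \<Longrightarrow> (G' has_real_derivative - q t * G t) (at t within {0..T})"
    and qQ: "\<And>t. t \<in> {0..T} \<Longrightarrow> q t \<le> Q t"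
    and "z 0 = 0" "z' 0 \<noteq> 0" and "G 0 = 0" "G' 0 > 0" "G T \<le> 0"
  shows "\<exists>t. 0 < t \<and> t \<le> T \<and> z t = 0"
proof -
  have *: "\<exists>t. 0 < t \<and> t \<le> T \<and> z t = 0"
    if z: "\<And>t. t \<in> {0..T} \<Longrightarrow> (z has_real_derivative z' t) (at t within {0..T})"
    and z': "\<And>t. t \<in> {0..T} \<Longrightarrow> (z' has_real_derivative - Q t * z t) (at t within {0..T})"
    and "z 0 = 0" "z' 0 > 0" for z z'
  proof (rule ccontr)
    assume no: "\<not> ?thesis"
    have contz: "continuous_on {0..T} z" and contz': "continuous_on {0..T} z'"
      and contG: "continuous_on {0..T} G" and contG': "continuous_on {0..T} G'"
      by (rule DERIV_continuous_on, erule z z' G G')+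
    have zpos: "z t > 0" if t: "0 < t" "t \<le> T" for t
    proof (rule ccontr)
      assume "\<not> z t > 0"
      then obtain \<sigma> where "0 < \<sigma>" "\<sigma> \<le> t" "z \<sigma> = 0"
        using first_zero[OF continuous_on_subset[OF contz] DERIV_subset[OF z]] t
          \<open>z 0 = 0\<close> \<open>z' 0 > 0\<close> by (smt (verit, best) atLeastAtMost_iff subsetI)
      then show False using no t by auto
    qed
    obtain \<tau> where \<tau>: "0 < \<tau>" "\<tau> \<le> T" "G \<tau> = 0" "\<And>t. 0 < t \<Longrightarrow> t < \<tau> \<Longrightarrow> G t > 0"
      using first_zero[OF contG G[of 0]] \<open>T > 0\<close> assms by auto
    have at: "at t within {0..T} = at t" if "0 < t" "t < \<tau>" for t
      using that \<tau> by (intro at_within_Icc_at) auto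
    define W where "W t = z' t * G t - z t * G' t" for t
    have W: "W t \<le> 0" if t: "0 \<le> t" "t \<le> \<tau>" for t
    proof -
      have "W t \<le> W 0"
      proof (rule DERIV_nonpos_imp_decreasing_open[of 0 t W])
        fix s assume s: "0 < s" "s < t"
        have "(W has_real_derivative (q s - Q s) * (z s * G s)) (at s)"
          unfolding W_def using z[of s] z'[of s] G[of s] G'[of s] at[of s] s t \<tau>
          by (auto intro!: derivative_eq_intros simp: algebra_simps)
        moreover have "(q s - Q s) * (z s * G s) \<le> 0"
          using qQ[of s] zpos[of s] \<tau>(4)[of s] s t \<tau>
          by (intro mult_nonpos_nonneg mult_nonneg_nonneg) (auto intro: less_imp_le)
        ultimately show "\<exists>y. (W has_real_derivative y) (at s) \<and> y \<le> 0" by blast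
      next
        show "continuous_on {0..t} W"
          unfolding W_def using t \<tau> contz contz' contG contG'
          by (intro continuous_intros) (auto elim!: continuous_on_subset)
      qed (use t in auto)
      also have "W 0 = 0" using \<open>z 0 = 0\<close> \<open>G 0 = 0\<close> by (simp add: W_def)
      finally show ?thesis .
    qed
    have "G (\<tau> / 2) / z (\<tau> / 2) \<le> G \<tau> / z \<tau>"
    proof (rule DERIV_nonneg_imp_increasing_open[of "\<tau> / 2" \<tau> "\<lambda>t. G t / z t"])
      fix s assume s: "\<tau> / 2 < s" "s < \<tau>"
      then have "z s > 0" using zpos[of s] \<tau> by auto
      have "((\<lambda>t. G t / z t) has_real_derivative - W s / (z s)\<^sup>2) (at s)"
        using z[of s] G[of s] at[of s] s \<tau> \<open>z s > 0\<close> unfolding W_def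
        by (auto intro!: derivative_eq_intros simp: power2_eq_square algebra_simps)
      moreover have "- W s / (z s)\<^sup>2 \<ge> 0"
        using W[of s] s \<tau> by (auto intro!: divide_nonpos_nonneg)
      ultimately show "\<exists>y. ((\<lambda>t. G t / z t) has_real_derivative y) (at s) \<and> 0 \<le> y" by blast
    next
      have "z t \<noteq> 0" if "t \<in> {\<tau> / 2..\<tau>}" for t
        using zpos[of t] \<tau> that by auto
      then show "continuous_on {\<tau> / 2..\<tau>} (\<lambda>t. G t / z t)"
        using contz contG \<tau>
        by (intro continuous_intros) (auto elim!: continuous_on_subset)
    qed (use \<tau> in auto)
    moreover have "G (\<tau> / 2) / z (\<tau> / 2) > 0"
      using \<tau> zpos[of "\<tau> / 2"] by auto
    ultimately show False using \<tau> by simp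
  qed
  show ?thesis
  proof (cases "z' 0 > 0")
    case True
    then show ?thesis using *[of z z'] assms by blast
  next
    case False
    then have "\<exists>t. 0 < t \<and> t \<le> T \<and> - z t = 0"
      using assms
      by (intro *[of "\<lambda>t. - z t" "\<lambda>t. - z' t"]) (auto intro!: derivative_eq_intros)
    then show ?thesis by simp
  qed
qed

section \<open>The half period of a pendulum\<close>

text \<open>
The integral with oriented limits is defined for negative amplitudes as well, which makes
it an antiderivative on the whole line.
\<close>

definition incomplete_K :: "real \<Rightarrow> real \<Rightarrow> real" where
  "incomplete_K m x = (LBINT \<theta>=0..x. 1 / sqrt (1 - m * (sin \<theta>)\<^sup>2))"

lemma elliptic_radicand_pos:
  fixes m \<theta> :: real
  assumes "0 \<le> m" "m < 1"
  shows "1 - m * (sin \<theta>)\<^sup>2 > 0"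
proof -
  have "m * (sin \<theta>)\<^sup>2 \<le> m * 1"
    using assms by (intro mult_left_mono) (auto simp: abs_square_le_1)
  then show ?thesis using assms by simp
qed

lemma continuous_on_elliptic_integrand:
  fixes m :: real
  assumes "0 \<le> m" "m < 1"
  shows "continuous_on S (\<lambda>\<theta>. 1 / sqrt (1 - m * (sin \<theta>)\<^sup>2))"
proof -
  have "sqrt (1 - m * (sin \<theta>)\<^sup>2) \<noteq> 0" for \<theta>
    using elliptic_radicand_pos[OF assms, of \<theta>] by simp
  then show ?thesis
    by (intro continuous_intros) auto
qed

lemma incomplete_K_derivative:
  assumes "0 \<le> m" "m < 1"
  shows "(incomplete_K m has_real_derivative 1 / sqrt (1 - m * (sin x)\<^sup>2)) (at x)"
proof -
  define R where "R = \<bar>x\<bar> + 1"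
  have "((\<lambda>u. LBINT \<theta>=0..u. 1 / sqrt (1 - m * (sin \<theta>)\<^sup>2))
           has_vector_derivative 1 / sqrt (1 - m * (sin x)\<^sup>2)) (at x within {- R..R})"
    using interval_integral_FTC2[of "- R" 0 R "\<lambda>\<theta>. 1 / sqrt (1 - m * (sin \<theta>)\<^sup>2)" x]
      continuous_on_elliptic_integrand[OF assms]
    by (auto simp: R_def zero_ereal_def)
  moreover have "at x within {- R..R} = at x"
    by (intro at_within_Icc_at) (auto simp: R_def)
  ultimately show ?thesis
    by (simp add: incomplete_K_def[abs_def] has_real_derivative_iff_has_vector_derivative)
qed

lemma incomplete_K_0: "incomplete_K m 0 = 0"
  by (simp add: incomplete_K_def zero_ereal_def)

lemma incomplete_K_half_pi:
  assumes "0 \<le> m" "m < 1"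
  shows "incomplete_K m (pi / 2) = elliptic_K m"
proof -
  have "set_integrable lborel {0..pi / 2} (\<lambda>\<theta>. 1 / sqrt (1 - m * (sin \<theta>)\<^sup>2))"
    by (intro borel_integrable_atLeastAtMost' continuous_on_elliptic_integrand[OF assms])
  then show ?thesis
    unfolding incomplete_K_def elliptic_K_def zero_ereal_def
    by (intro interval_integral_eq_integral) auto
qed

lemma incomplete_K_add_pi:
  assumes "0 \<le> m" "m < 1"
  shows "incomplete_K m (x + pi) = incomplete_K m x + 2 * elliptic_K m"
proof -
  note der = DERIV_chain2[OF incomplete_K_derivative[OF assms]]
  have "\<exists>c. \<forall>y\<in>UNIV. incomplete_K m (y + pi) - incomplete_K m y = c"
    by (rule has_field_derivative_zero_constant)
       (auto intro!: derivative_eq_intros der incomplete_K_derivative assms)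
  then have 1: "incomplete_K m (x + pi) - incomplete_K m x = incomplete_K m (0 + pi) - incomplete_K m 0"
    by (metis UNIV_I)
  \<comment> \<open>the reflection about \<open>pi / 2\<close> shows that the two halves of the period contribute equally\<close>
  have "\<exists>c. \<forall>y\<in>UNIV. incomplete_K m (pi - y) + incomplete_K m y = c"
    by (rule has_field_derivative_zero_constant)
       (auto intro!: derivative_eq_intros der incomplete_K_derivative assms)
  then have "incomplete_K m (pi - pi / 2) + incomplete_K m (pi / 2)
      = incomplete_K m (pi - 0) + incomplete_K m 0"
    by (metis UNIV_I)
  then have "2 * elliptic_K m = incomplete_K m pi"
    by (simp add: incomplete_K_0 incomplete_K_half_pi[OF assms])
  with 1 show ?thesis by (simp add: incomplete_K_0)
qed

lemma strict_mono_incomplete_K: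
  assumes "0 \<le> m" "m < 1"
  shows "strict_mono (incomplete_K m)"
proof (rule strict_monoI)
  fix x y :: real assume "x < y"
  then show "incomplete_K m x < incomplete_K m y"
    by (rule DERIV_pos_imp_increasing)
       (use elliptic_radicand_pos[OF assms] incomplete_K_derivative[OF assms] in fastforce)
qed

lemma elliptic_K_pos:
  assumes "0 \<le> m" "m < 1"
  shows "elliptic_K m > 0"
  using strict_monoD[OF strict_mono_incomplete_K[OF assms], of 0 "pi / 2"] incomplete_K_0
    incomplete_K_half_pi[OF assms] by simp

lemma constant_sign:
  fixes P :: "real \<Rightarrow> real"
  assumes "continuous_on {0..T} P" "\<And>t. t \<in> {0..T} \<Longrightarrow> P t \<noteq> 0" "t \<in> {0..T}"
  shows "sgn (P t) = sgn (P 0)"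
proof -
  have c: "continuous_on {0..t} P"
    using assms by (auto elim!: continuous_on_subset)
  have "False" if "P 0 < 0" "P t > 0"
    using IVT'[of P 0 0 t] that assms c by fastforce
  moreover have "False" if "P 0 > 0" "P t < 0"
    using IVT2'[of P t 0 0] that assms c by fastforce
  ultimately show ?thesis
    using assms(2)[of t] assms(2)[of 0] assms(3)
    by (metis atLeastAtMost_iff linorder_neqE_linordered_idom order_refl order_trans sgn_neg sgn_pos)
qed

text \<open>
The vector \<open>(x, y)\<close> rotates on a circle of radius \<open>r\<close> with angular velocity \<open>P\<close>. Since the
square of \<open>P\<close> is \<open>C\<^sup>2\<close> times the elliptic radicand of the angle, \<open>P\<close> never vanishes and so
keeps its sign;
hence the elliptic integral of the angle grows linearly in time, and a half turn takes exactly
the time \<open>2 K(m) / C\<close>. Both the oscillating and the rotating regime of a pendulum have this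
form, with different choices of the rotating vector.
\<close>

lemma rotation_half_turn:
  fixes x y P :: "real \<Rightarrow> real"
  assumes m: "0 \<le> m" "m < 1" and "C > 0" "r > 0" and T: "T = 2 * elliptic_K m / C"
    and x: "\<And>t. t \<in> {0..T} \<Longrightarrow> (x has_real_derivative P t * y t) (at t within {0..T})"
    and y: "\<And>t. t \<in> {0..T} \<Longrightarrow> (y has_real_derivative - P t * x t) (at t within {0..T})"
    and P: "continuous_on {0..T} P"
    and P2: "\<And>t. t \<in> {0..T} \<Longrightarrow> (P t)\<^sup>2 = C\<^sup>2 * (1 - m * (x t / r)\<^sup>2)"
    and r: "(x 0)\<^sup>2 + (y 0)\<^sup>2 = r\<^sup>2"
  shows "x T = - x 0" "y T = - y 0" "P T = P 0"
proof -
  have "T > 0" using T \<open>C > 0\<close> elliptic_K_pos[OF m] by simp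
  have "(x 0 / r)\<^sup>2 + (y 0 / r)\<^sup>2 = 1"
    using r \<open>r > 0\<close> by (simp add: power_divide add_divide_distrib[symmetric])
  then obtain \<theta>0 where "y 0 / r = cos \<theta>0" "x 0 / r = sin \<theta>0"
    using sincos_total_2pi[of "y 0 / r" "x 0 / r"] by (metis add.commute)
  then have \<theta>0: "x 0 = r * sin \<theta>0" "y 0 = r * cos \<theta>0"
    using \<open>r > 0\<close> by (simp_all add: field_simps)
  define \<theta> where "\<theta> t = \<theta>0 + integral {0..t} P" for t
  have d\<theta>: "(\<theta> has_real_derivative P t) (at t within {0..T})" if "t \<in> {0..T}" for t
    unfolding \<theta>_def using integral_has_real_derivative[OF P that]
    by (auto intro!: derivative_eq_intros)
  \<comment> \<open>in the frame that turns with the angle \<open>\<theta>\<close> the vector is at rest,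
    so \<open>\<theta>\<close> is a differentiable polar angle of it\<close>
  have "\<exists>c. \<forall>t\<in>{0..T}. x t * cos (\<theta> t) - y t * sin (\<theta> t) = c"
    by (rule has_field_derivative_zero_constant)
       (auto intro!: derivative_eq_intros d\<theta> x y simp: algebra_simps)
  then have 1: "x t * cos (\<theta> t) - y t * sin (\<theta> t) = 0" if "t \<in> {0..T}" for t
    using that \<open>T > 0\<close> \<theta>0 by (force simp: \<theta>_def)
  have "\<exists>c. \<forall>t\<in>{0..T}. x t * sin (\<theta> t) + y t * cos (\<theta> t) = c"
    by (rule has_field_derivative_zero_constant)
       (auto intro!: derivative_eq_intros d\<theta> x y simp: algebra_simps)
  then have "x t * sin (\<theta> t) + y t * cos (\<theta> t) = x 0 * sin (\<theta> 0) + y 0 * cos (\<theta> 0)"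
    if "t \<in> {0..T}" for t
    using that \<open>T > 0\<close> by force
  moreover have "x 0 * sin (\<theta> 0) + y 0 * cos (\<theta> 0) = r * ((sin \<theta>0)\<^sup>2 + (cos \<theta>0)\<^sup>2)"
    by (simp only: power2_eq_square distrib_left mult.assoc \<theta>0) (simp add: \<theta>_def)
  ultimately have 2: "x t * sin (\<theta> t) + y t * cos (\<theta> t) = r" if "t \<in> {0..T}" for t
    using that by simp
  have xt: "x t = r * sin (\<theta> t)" and yt: "y t = r * cos (\<theta> t)" if "t \<in> {0..T}" for t
  proof -
    have "x t = x t * ((sin (\<theta> t))\<^sup>2 + (cos (\<theta> t))\<^sup>2)" by simp
    also have "\<dots> = (x t * sin (\<theta> t) + y t * cos (\<theta> t)) * sin (\<theta> t)
        + (x t * cos (\<theta> t) - y t * sin (\<theta> t)) * cos (\<theta> t)"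
      by algebra
    finally show "x t = r * sin (\<theta> t)" using 1[OF that] 2[OF that] by simp
    have "y t = y t * ((sin (\<theta> t))\<^sup>2 + (cos (\<theta> t))\<^sup>2)" by simp
    also have "\<dots> = (x t * sin (\<theta> t) + y t * cos (\<theta> t)) * cos (\<theta> t)
        - (x t * cos (\<theta> t) - y t * sin (\<theta> t)) * sin (\<theta> t)"
      by algebra
    finally show "y t = r * cos (\<theta> t)" using 1[OF that] 2[OF that] by simp
  qed
  define w where "w t = sqrt (1 - m * (sin (\<theta> t))\<^sup>2)" for t
  have wpos: "w t > 0" for t
    using elliptic_radicand_pos[OF m] by (simp add: w_def)
  have absP: "\<bar>P t\<bar> = C * w t" if "t \<in> {0..T}" for t
  proof -
    have "(P t)\<^sup>2 = (C * w t)\<^sup>2"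
      using P2[OF that] xt[OF that] \<open>r > 0\<close> elliptic_radicand_pos[OF m, of "\<theta> t"]
      by (simp add: w_def power_mult_distrib less_imp_le)
    then show ?thesis
      using wpos[of t] \<open>C > 0\<close> by (metis abs_mult abs_of_pos power2_eq_iff abs_minus_cancel)
  qed
  then have Pn0: "P t \<noteq> 0" if "t \<in> {0..T}" for t
    using that wpos[of t] \<open>C > 0\<close> by fastforce
  define \<sigma> where "\<sigma> = sgn (P 0)"
  have Pt: "P t = \<sigma> * C * w t" if "t \<in> {0..T}" for t
    using absP[OF that] constant_sign[OF P Pn0 that] unfolding \<sigma>_def
    by (metis mult.assoc mult_sgn_abs)
  have "\<exists>c. \<forall>t\<in>{0..T}. incomplete_K m (\<theta> t) - \<sigma> * C * t = c"
  proof (rule has_field_derivative_zero_constant)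
    fix t assume t: "t \<in> {0..T}"
    have "((\<lambda>t. incomplete_K m (\<theta> t) - \<sigma> * C * t) has_real_derivative
        1 / w t * P t - \<sigma> * C) (at t within {0..T})"
      unfolding w_def
      by (auto intro!: derivative_eq_intros DERIV_chain2[OF incomplete_K_derivative[OF m]] d\<theta> t)
    then show "((\<lambda>t. incomplete_K m (\<theta> t) - \<sigma> * C * t) has_real_derivative 0) (at t within {0..T})"
      using Pt[OF t] wpos[of t] by simp
  qed auto
  then obtain c where c: "\<And>t. t \<in> {0..T} \<Longrightarrow> incomplete_K m (\<theta> t) - \<sigma> * C * t = c"
    by blast
  have CT: "C * T = 2 * elliptic_K m" using T \<open>C > 0\<close> by simp
  have "\<sigma> = 1 \<or> \<sigma> = -1"
    using Pn0[of 0] \<open>T > 0\<close> by (auto simp: \<sigma>_def sgn_real_def)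
  then have "incomplete_K m (\<theta> T) = incomplete_K m (\<theta> 0 + \<sigma> * pi)"
    using c[of 0] c[of T] CT \<open>T > 0\<close> incomplete_K_add_pi[OF m, of "\<theta> 0"]
      incomplete_K_add_pi[OF m, of "\<theta> 0 - pi"] by (auto simp: mult.assoc)
  then have "\<theta> T = \<theta> 0 + \<sigma> * pi"
    using strict_mono_eq[OF strict_mono_incomplete_K[OF m]] by blast
  then have flip: "sin (\<theta> T) = - sin (\<theta> 0)" "cos (\<theta> T) = - cos (\<theta> 0)"
    using \<open>\<sigma> = 1 \<or> \<sigma> = -1\<close> by (auto simp: sin_diff cos_diff)
  then show "x T = - x 0" "y T = - y 0" "P T = P 0"
    using xt[of 0] xt[of T] yt[of 0] yt[of T] Pt[of 0] Pt[of T] \<open>T > 0\<close>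
    by (auto simp: w_def)
qed

section \<open>The height of a geodesic above the singular set\<close>

locale geodesic =
  fixes a :: real and \<gamma> p :: "real \<Rightarrow> real^3"
  assumes a_pos: "0 < a" and a_less_1: "a < 1" and geodesic: "arclength_geodesic a \<gamma> p"
begin

abbreviation b :: real where "b \<equiv> sqrt (1 - a\<^sup>2)"
abbreviation \<gamma>1 :: "real \<Rightarrow> real" where "\<gamma>1 t \<equiv> \<gamma> t $ 1"
abbreviation \<gamma>2 :: "real \<Rightarrow> real" where "\<gamma>2 t \<equiv> \<gamma> t $ 2"
abbreviation \<gamma>3 :: "real \<Rightarrow> real" where "\<gamma>3 t \<equiv> \<gamma> t $ 3"
abbreviation p1 :: "real \<Rightarrow> real" where "p1 t \<equiv> p t $ 1"
abbreviation p2 :: "real \<Rightarrow> real" where "p2 t \<equiv> p t $ 2"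
abbreviation p3 :: "real \<Rightarrow> real" where "p3 t \<equiv> p t $ 3"

lemma a2: "0 < a\<^sup>2" "a\<^sup>2 < 1"
  using a_pos a_less_1 by (auto simp: power_less_one_iff abs_square_less_1)

lemma b_pos: "b > 0" and b2: "b\<^sup>2 = 1 - a\<^sup>2"
  using a2 by simp_all

lemma covector_norm: "t \<ge> 0 \<Longrightarrow> (p1 t)\<^sup>2 + (p2 t)\<^sup>2 = 1"
  and in_sphere: "t \<ge> 0 \<Longrightarrow> \<gamma> t \<in> sphere 0 1"
  using geodesic by (auto simp: arclength_geodesic_def)

lemma sphere_eq: "t \<ge> 0 \<Longrightarrow> (\<gamma>1 t)\<^sup>2 + (\<gamma>2 t)\<^sup>2 + (\<gamma>3 t)\<^sup>2 = 1"
  using in_sphere[of t] by (simp add: norm_vec_def L2_set_def sum_3)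

lemma geodesic_vector_derivative:
  "t \<ge> 0 \<Longrightarrow> (\<gamma> has_vector_derivative \<gamma> t \<times> omega a (p1 t) (p2 t)) (at t within {0..})"
  using geodesic by (simp add: arclength_geodesic_def)

lemma geodesic_derivatives:
  assumes "t \<ge> 0"
  shows "(\<gamma>1 has_real_derivative - \<gamma>3 t * p1 t) (at t within {0..})"
    and "(\<gamma>2 has_real_derivative b * \<gamma>3 t * p2 t) (at t within {0..})"
    and "(\<gamma>3 has_real_derivative \<gamma>1 t * p1 t - b * \<gamma>2 t * p2 t) (at t within {0..})"
    and "(p1 has_real_derivative p3 t * p2 t) (at t within {0..})"
    and "(p2 has_real_derivative - p3 t * p1 t) (at t within {0..})"
    and "(p3 has_real_derivative a\<^sup>2 * p1 t * p2 t) (at t within {0..})"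
proof -
  note \<gamma>' = bounded_linear.has_vector_derivative[OF bounded_linear_vec_nth
      geodesic_vector_derivative[OF assms]]
  show "(\<gamma>1 has_real_derivative - \<gamma>3 t * p1 t) (at t within {0..})"
    "(\<gamma>2 has_real_derivative b * \<gamma>3 t * p2 t) (at t within {0..})"
    "(\<gamma>3 has_real_derivative \<gamma>1 t * p1 t - b * \<gamma>2 t * p2 t) (at t within {0..})"
    using \<gamma>'[of 1] \<gamma>'[of 2] \<gamma>'[of 3]
    by (simp_all add: has_real_derivative_iff_has_vector_derivative cross_components omega_def
        axis_def algebra_simps)
  have "(p has_vector_derivative
           vector [p t $ 3 * p t $ 2, - (p t $ 3 * p t $ 1), a\<^sup>2 * p t $ 1 * p t $ 2])
          (at t within {0..})"
    using geodesic assms by (simp add: arclength_geodesic_def)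
  note p' = bounded_linear.has_vector_derivative[OF bounded_linear_vec_nth this]
  show "(p1 has_real_derivative p3 t * p2 t) (at t within {0..})"
    "(p2 has_real_derivative - p3 t * p1 t) (at t within {0..})"
    "(p3 has_real_derivative a\<^sup>2 * p1 t * p2 t) (at t within {0..})"
    using p'[of 1] p'[of 2] p'[of 3]
    by (simp_all add: has_real_derivative_iff_has_vector_derivative)
qed

lemma geodesic_continuous:
  "continuous_on {0..} p1" "continuous_on {0..} p2" "continuous_on {0..} p3"
  using geodesic_derivatives by (auto intro!: DERIV_continuous_on)

text \<open>
The left-hand side is constant along a geodesic because \<open>b\<^sup>2 + a\<^sup>2 = 1\<close>, and it vanishes
initially by the condition on the initial covector.
\<close>

lemma transversality:
  assumes "t \<ge> 0"
  shows "p2 t * \<gamma>1 t + b * p1 t * \<gamma>2 t + p3 t * \<gamma>3 t = 0"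
proof -
  have "\<exists>c. \<forall>t\<in>{0..}. p2 t * \<gamma>1 t + b * p1 t * \<gamma>2 t + p3 t * \<gamma>3 t = c"
  proof (rule has_field_derivative_zero_constant)
    fix t :: real assume t: "t \<in> {0..}"
    have "((\<lambda>t. p2 t * \<gamma>1 t + b * p1 t * \<gamma>2 t + p3 t * \<gamma>3 t) has_real_derivative
        p2 t * (- \<gamma>3 t * p1 t) + (- p3 t * p1 t) * \<gamma>1 t
        + (b * p1 t * (b * \<gamma>3 t * p2 t) + b * (p3 t * p2 t) * \<gamma>2 t)
        + (p3 t * (\<gamma>1 t * p1 t - b * \<gamma>2 t * p2 t) + a\<^sup>2 * p1 t * p2 t * \<gamma>3 t))
        (at t within {0..})"
      using t by (auto intro!: derivative_eq_intros geodesic_derivatives)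
    also have "p2 t * (- \<gamma>3 t * p1 t) + (- p3 t * p1 t) * \<gamma>1 t
        + (b * p1 t * (b * \<gamma>3 t * p2 t) + b * (p3 t * p2 t) * \<gamma>2 t)
        + (p3 t * (\<gamma>1 t * p1 t - b * \<gamma>2 t * p2 t) + a\<^sup>2 * p1 t * p2 t * \<gamma>3 t) = 0"
      using b2 by algebra
    finally show "((\<lambda>t. p2 t * \<gamma>1 t + b * p1 t * \<gamma>2 t + p3 t * \<gamma>3 t) has_real_derivative 0)
        (at t within {0..})" .
  qed auto
  moreover have "p2 0 * \<gamma>1 0 + b * p1 0 * \<gamma>2 0 + p3 0 * \<gamma>3 0 = 0"
    using geodesic by (simp add: arclength_geodesic_def)
  ultimately show ?thesis using assms by force
qed

text \<open>
With \<open>p1 = cos \<psi>\<close> and \<open>p2 = - sin \<psi>\<close> the covector equations are those of a pendulum with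
angle \<open>2 \<psi>\<close>, and this is its energy, normalised to vanish at the stable equilibrium. In
terms of the energy \<open>E\<close> it is \<open>(E + a\<^sup>2) / 2\<close>.
\<close>

definition pendulum_energy :: real where "pendulum_energy = (p3 0)\<^sup>2 + a\<^sup>2 * (p2 0)\<^sup>2"

lemma pendulum_energy_conserved:
  assumes "t \<ge> 0"
  shows "(p3 t)\<^sup>2 + a\<^sup>2 * (p2 t)\<^sup>2 = pendulum_energy"
proof -
  have "\<exists>c. \<forall>t\<in>{0..}. (p3 t)\<^sup>2 + a\<^sup>2 * (p2 t)\<^sup>2 = c"
  proof (rule has_field_derivative_zero_constant)
    fix t :: real assume t: "t \<in> {0..}"
    show "((\<lambda>t. (p3 t)\<^sup>2 + a\<^sup>2 * (p2 t)\<^sup>2) has_real_derivative 0) (at t within {0..})"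
      using t by (auto intro!: derivative_eq_intros geodesic_derivatives simp: algebra_simps)
  qed auto
  then show ?thesis using assms unfolding pendulum_energy_def by force
qed

lemma energy_eq_pendulum_energy:
  assumes "p 0 \<in> cylinder"
  shows "energy a (p 0) = 2 * pendulum_energy - a\<^sup>2"
proof -
  have "(p1 0)\<^sup>2 + (p2 0)\<^sup>2 = 1" using assms by (simp add: cylinder_def)
  then show ?thesis
    unfolding energy_eq[OF assms] pendulum_energy_def by algebra
qed

text \<open>
On a geodesic this is \<open>p1\<^sup>2 + b\<^sup>2 p2\<^sup>2 + p3\<^sup>2\<close>, written in terms of \<open>p2\<close> alone.
\<close>

definition stiffness :: "real \<Rightarrow> real" where
  "stiffness t = 1 + pendulum_energy - 2 * a\<^sup>2 * (p2 t)\<^sup>2"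

abbreviation \<gamma>3' :: "real \<Rightarrow> real" where
  "\<gamma>3' t \<equiv> \<gamma>1 t * p1 t - b * \<gamma>2 t * p2 t"

text \<open>
This equation is the key to the cut time bounds: the height above the singular set
oscillates like a spring, with a stiffness that depends on the covector only. The terms
that contain the horizontal coordinates cancel by the conserved transversality relation.
\<close>

lemma height_equation:
  assumes "t \<ge> 0"
  shows "(\<gamma>3' has_real_derivative - stiffness t * \<gamma>3 t) (at t within {0..})"
proof -
  have "(\<gamma>3' has_real_derivative (- \<gamma>3 t * p1 t) * p1 t + \<gamma>1 t * (p3 t * p2 t)
      - (b * (b * \<gamma>3 t * p2 t) * p2 t + b * \<gamma>2 t * (- p3 t * p1 t))) (at t within {0..})"
    using assms by (auto intro!: derivative_eq_intros geodesic_derivatives simp: algebra_simps)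
  also have "(- \<gamma>3 t * p1 t) * p1 t + \<gamma>1 t * (p3 t * p2 t)
      - (b * (b * \<gamma>3 t * p2 t) * p2 t + b * \<gamma>2 t * (- p3 t * p1 t)) = - stiffness t * \<gamma>3 t"
    using transversality[OF assms] covector_norm[OF assms] pendulum_energy_conserved[OF assms] b2
    unfolding stiffness_def by algebra
  finally show ?thesis .
qed

text \<open>
The covector component \<open>p2\<close> satisfies the height equation up to the constant shift \<open>b\<^sup>2\<close> of
the stiffness. This gives explicit equations with which to compare the height.
\<close>

lemma covector_equation:
  assumes "t \<ge> 0"
  shows "((\<lambda>t. - p3 t * p1 t) has_real_derivative - (stiffness t - b\<^sup>2) * p2 t) (at t within {0..})"
proof -
  have "((\<lambda>t. - p3 t * p1 t) has_real_derivative
      - (a\<^sup>2 * p1 t * p2 t) * p1 t - p3 t * (p3 t * p2 t)) (at t within {0..})"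
    using assms by (auto intro!: derivative_eq_intros geodesic_derivatives simp: algebra_simps)
  also have "- (a\<^sup>2 * p1 t * p2 t) * p1 t - p3 t * (p3 t * p2 t) = - (stiffness t - b\<^sup>2) * p2 t"
    using covector_norm[OF assms] pendulum_energy_conserved[OF assms] b2
    unfolding stiffness_def by algebra
  finally show ?thesis .
qed

text \<open>
On the equator, transversality makes \<open>(\<gamma>1, \<gamma>2)\<close> a multiple of \<open>(b p1, - p2)\<close>, so the vertical
velocity is a nonzero multiple of \<open>b p1\<^sup>2 + b p2\<^sup>2\<close>.
\<close>

lemma height_slope_nonzero:
  assumes "t \<ge> 0" "\<gamma>3 t = 0"
  shows "\<gamma>3' t \<noteq> 0"
proof
  assume 0: "\<gamma>3' t = 0"
  have 1: "p2 t * \<gamma>1 t + b * p1 t * \<gamma>2 t = 0" "(\<gamma>1 t)\<^sup>2 + (\<gamma>2 t)\<^sup>2 = 1"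
    using transversality[of t] sphere_eq[of t] assms by auto
  have "\<gamma>1 t = 0" using 0 1(1) covector_norm[OF assms(1)] by algebra
  moreover have "b * \<gamma>2 t = 0" using 0 1(1) covector_norm[OF assms(1)] by algebra
  ultimately show False using 1(2) b_pos by simp
qed

lemma height_zero_by_comparison:
  fixes G G' q :: "real \<Rightarrow> real"
  assumes "T > 0" "\<gamma>3 0 = 0"
    and "\<And>t. t \<in> {0..T} \<Longrightarrow> (G has_real_derivative G' t) (at t within {0..T})"
    and "\<And>t. t \<in> {0..T} \<Longrightarrow> (G' has_real_derivative - q t * G t) (at t within {0..T})"
    and "\<And>t. t \<in> {0..T} \<Longrightarrow> q t \<le> stiffness t"
    and "G 0 = 0" "G' 0 > 0" "G T \<le> 0"
  shows "\<exists>t. 0 < t \<and> t \<le> T \<and> \<gamma>3 t = 0"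
proof (rule sturm_comparison_zero[of T \<gamma>3 \<gamma>3' stiffness G G' q])
  fix t assume "t \<in> {0..T}"
  then show "(\<gamma>3 has_real_derivative \<gamma>3' t) (at t within {0..T})"
    and "(\<gamma>3' has_real_derivative - stiffness t * \<gamma>3 t) (at t within {0..T})"
    using DERIV_subset[OF geodesic_derivatives(3), of t "{0..T}"]
      DERIV_subset[OF height_equation, of t "{0..T}"] by simp_all
qed (use assms height_slope_nonzero[of 0] in auto)

lemma height_zero_constant_stiffness:
  assumes "\<gamma>3 0 = 0" "\<kappa> > 0" "\<And>t. t \<ge> 0 \<Longrightarrow> \<kappa>\<^sup>2 \<le> stiffness t"
  shows "\<exists>t. 0 < t \<and> t \<le> pi / \<kappa> \<and> \<gamma>3 t = 0"
  using assms
  by (intro height_zero_by_comparison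
        [of "pi / \<kappa>" "\<lambda>t. sin (\<kappa> * t)" "\<lambda>t. \<kappa> * cos (\<kappa> * t)" "\<lambda>t. \<kappa>\<^sup>2"])
     (auto intro!: derivative_eq_intros simp: power2_eq_square)

text \<open>
The bound is the half period \<open>T\<close> of the covector. The equation \<open>f'' = - q f\<close> of \<open>f = p2\<close> is
explicitly solvable: besides \<open>f\<close> it has the solution \<open>f A - f'\<close>, where \<open>A\<close> is the
antiderivative of \<open>a\<^sup>2 f\<^sup>2\<close>. (Reduction of order gives \<open>f\<close> times an antiderivative of
\<open>1 / f\<^sup>2\<close>; that integral is computed from \<open>(f' / f)' = a\<^sup>2 f\<^sup>2 - c / f\<^sup>2\<close>, where \<open>c\<close> is
the pendulum energy.) The combination \<open>G\<close> that vanishes at \<open>0\<close> has initial slope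
\<open>c > 0\<close>, and since \<open>f\<close> and \<open>f'\<close> change sign over a half period,
\<open>G T = - f(0)\<^sup>2 A(T) \<le> 0\<close>. So \<open>G\<close>, and by comparison the height, vanishes by the time \<open>T\<close>.
\<close>

lemma height_zero_half_period:
  assumes "T > 0" "\<gamma>3 0 = 0" "pendulum_energy > 0"
    and p2T: "p2 T = - p2 0" and p31T: "p3 T * p1 T = - (p3 0 * p1 0)"
  shows "\<exists>t. 0 < t \<and> t \<le> T \<and> \<gamma>3 t = 0"
proof -
  define f f' q A where "f = p2" and "f' t = - p3 t * p1 t" and "q t = stiffness t - b\<^sup>2"
    and "A t = integral {0..t} (\<lambda>s. a\<^sup>2 * (p2 s)\<^sup>2)" for t
  have f: "(f has_real_derivative f' t) (at t within {0..T})"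
    and f': "(f' has_real_derivative - q t * f t) (at t within {0..T})" if "t \<in> {0..T}" for t
    using that DERIV_subset[OF geodesic_derivatives(5), of t "{0..T}"]
      DERIV_subset[OF covector_equation, of t "{0..T}"]
    by (auto simp: f_def f'_def[abs_def] q_def)
  have cont: "continuous_on {0..T} (\<lambda>s. a\<^sup>2 * (p2 s)\<^sup>2)"
    using geodesic_continuous(2)
    by (auto intro!: continuous_intros elim!: continuous_on_subset)
  have A: "(A has_real_derivative a\<^sup>2 * (f t)\<^sup>2) (at t within {0..T})" if "t \<in> {0..T}" for t
    using integral_has_real_derivative[OF cont that] by (simp add: A_def[abs_def] f_def)
  have q: "(q has_real_derivative - 4 * a\<^sup>2 * f t * f' t) (at t within {0..T})"
    if "t \<in> {0..T}" for t
    unfolding q_def stiffness_def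
    using that by (auto intro!: derivative_eq_intros f[unfolded f_def] simp: f_def)
  define G where "G t = f 0 * (f t * A t - f' t) + f' 0 * f t" for t
  define G' where
    "G' t = f 0 * (f' t * A t + a\<^sup>2 * f t ^ 3 + q t * f t) + f' 0 * f' t" for t
  show ?thesis
  proof (rule height_zero_by_comparison[of T G G' q])
    fix t assume t: "t \<in> {0..T}"
    show "(G has_real_derivative G' t) (at t within {0..T})"
      unfolding G_def G'_def using t
      by (auto intro!: derivative_eq_intros f f' A simp: algebra_simps power2_eq_square power3_eq_cube)
    show "(G' has_real_derivative - q t * G t) (at t within {0..T})"
      unfolding G_def G'_def using t
      by (auto intro!: derivative_eq_intros f f' A q simp: algebra_simps power2_eq_square power3_eq_cube)
    show "q t \<le> stiffness t" using a2 by (simp add: q_def)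
  next
    have "A 0 = 0" by (simp add: A_def)
    then show "G 0 = 0" by (simp add: G_def)
    have "G' 0 = pendulum_energy"
      using \<open>A 0 = 0\<close> covector_norm[OF order_refl] pendulum_energy_conserved[OF order_refl] b2
      unfolding G'_def q_def stiffness_def f_def f'_def by algebra
    then show "G' 0 > 0" using assms by simp
    have "A T \<ge> 0" unfolding A_def by (intro integral_nonneg integrable_continuous_real cont) auto
    have "G T = - (f 0)\<^sup>2 * A T"
      using p2T p31T unfolding G_def f_def f'_def by algebra
    then show "G T \<le> 0" using \<open>A T \<ge> 0\<close> by simp
  qed (use assms in auto)
qed

end

section \<open>Operations on admissible curves\<close>

definition join :: "real \<Rightarrow> (real \<Rightarrow> 'a) \<Rightarrow> (real \<Rightarrow> 'a) \<Rightarrow> real \<Rightarrow> 'a" where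
  "join T f g t = (if t \<le> T then f t else g (t - T))"

lemma has_integral_join:
  fixes f g :: "real \<Rightarrow> 'a::banach"
  assumes f: "(f has_integral I) {0..T}" and g: "(g has_integral J) {0..s}" and "0 \<le> T" "0 \<le> s"
  shows "(join T f g has_integral (I + J)) {0..T + s}"
proof (rule has_integral_combine)
  show "(join T f g has_integral I) {0..T}"
    by (rule has_integral_eq[OF _ f]) (auto simp: join_def)
  have "((\<lambda>t. g (t + - T)) has_integral J) {0 - - T..s - - T}"
    by (rule has_integral_shift_real_ivl[OF g])
  then have "((\<lambda>t. g (t - T)) has_integral J) {T..T + s}"
    by (simp add: add.commute)
  then show "(join T f g has_integral J) {T..T + s}"
    by (rule has_integral_spike_finite[of "{T}", rotated -1]) (auto simp: join_def)
qed (use assms in auto)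

lemma absolutely_integrable_on_join:
  fixes f g :: "real \<Rightarrow> real"
  assumes f: "f absolutely_integrable_on {0..T}" and g: "g absolutely_integrable_on {0..s}"
    and "0 \<le> T" "0 \<le> s"
  shows "join T f g absolutely_integrable_on {0..T + s}"
proof -
  have "join T f g integrable_on {0..T + s}"
    using f g has_integral_join[OF _ _ \<open>0 \<le> T\<close> \<open>0 \<le> s\<close>]
    unfolding absolutely_integrable_on_def integrable_on_def by blast
  moreover have "join T (\<lambda>t. norm (f t)) (\<lambda>t. norm (g t)) integrable_on {0..T + s}"
    using f g has_integral_join[OF _ _ \<open>0 \<le> T\<close> \<open>0 \<le> s\<close>]
    unfolding absolutely_integrable_on_def integrable_on_def by blast
  moreover have "join T (\<lambda>t. norm (f t)) (\<lambda>t. norm (g t)) = (\<lambda>t. norm (join T f g t))"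
    by (auto simp: join_def)
  ultimately show ?thesis by (simp add: absolutely_integrable_on_def)
qed

lemma speed_integrable:
  fixes u1 u2 :: "real \<Rightarrow> real"
  assumes "u1 absolutely_integrable_on S" "u2 absolutely_integrable_on S"
  shows "(\<lambda>t. sqrt ((u1 t)\<^sup>2 + (u2 t)\<^sup>2)) integrable_on S"
proof -
  have "(\<lambda>t. u1 t *\<^sub>R (1::real, 0::real) + u2 t *\<^sub>R (0, 1)) absolutely_integrable_on S"
    using assms by (intro set_integral_add absolutely_integrable_scaleR_right) auto
  then show ?thesis
    by (simp add: absolutely_integrable_on_def norm_Pair)
qed

lemma admissible_join:
  assumes 1: "admissible a T \<eta> u1 u2" and 2: "admissible a s \<zeta> v1 v2" and eq: "\<eta> T = \<zeta> 0"
  shows "admissible a (T + s) (join T \<eta> \<zeta>) (join T u1 v1) (join T u2 v2)"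
    and "curve_length (T + s) (join T u1 v1) (join T u2 v2)
      = curve_length T u1 u2 + curve_length s v1 v2"
    and "join T \<eta> \<zeta> 0 = \<eta> 0" "join T \<eta> \<zeta> (T + s) = \<zeta> s"
proof -
  have T: "0 \<le> T" "0 \<le> s" using 1 2 by (auto simp: admissible_def)
  have u: "u1 absolutely_integrable_on {0..T}" "u2 absolutely_integrable_on {0..T}"
    "v1 absolutely_integrable_on {0..s}" "v2 absolutely_integrable_on {0..s}"
    using 1 2 by (auto simp: admissible_def)
  show start: "join T \<eta> \<zeta> 0 = \<eta> 0" and "join T \<eta> \<zeta> (T + s) = \<zeta> s"
    using T eq by (auto simp: join_def)
  show "curve_length (T + s) (join T u1 v1) (join T u2 v2)
      = curve_length T u1 u2 + curve_length s v1 v2"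
  proof -
    have "(join T (\<lambda>t. sqrt ((u1 t)\<^sup>2 + (u2 t)\<^sup>2)) (\<lambda>t. sqrt ((v1 t)\<^sup>2 + (v2 t)\<^sup>2)) has_integral
        curve_length T u1 u2 + curve_length s v1 v2) {0..T + s}"
      unfolding curve_length_def
      using u T by (intro has_integral_join integrable_integral speed_integrable)
    moreover have "join T (\<lambda>t. sqrt ((u1 t)\<^sup>2 + (u2 t)\<^sup>2)) (\<lambda>t. sqrt ((v1 t)\<^sup>2 + (v2 t)\<^sup>2))
        = (\<lambda>t. sqrt ((join T u1 v1 t)\<^sup>2 + (join T u2 v2 t)\<^sup>2))"
      by (auto simp: join_def)
    ultimately show ?thesis
      by (simp add: curve_length_def integral_unique)
  qed
  let ?V = "\<lambda>t. \<eta> t \<times> omega a (u1 t) (u2 t)" and ?W = "\<lambda>t. \<zeta> t \<times> omega a (v1 t) (v2 t)"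
  have velocity: "(\<lambda>t. join T \<eta> \<zeta> t \<times> omega a (join T u1 v1 t) (join T u2 v2 t)) = join T ?V ?W"
    by (auto simp: join_def)
  have V: "(?V has_integral \<eta> t - \<eta> 0) {0..t}" if "t \<in> {0..T}" for t
    using 1 that by (auto simp: admissible_def)
  have W: "(?W has_integral \<zeta> t - \<zeta> 0) {0..t}" if "t \<in> {0..s}" for t
    using 2 that by (auto simp: admissible_def)
  have "(join T ?V ?W has_integral (join T \<eta> \<zeta> t - join T \<eta> \<zeta> 0)) {0..t}"
    if t: "t \<in> {0..T + s}" for t
  proof (cases "t \<le> T")
    case True
    then have "(?V has_integral (join T \<eta> \<zeta> t - join T \<eta> \<zeta> 0)) {0..t}"
      using V[of t] t start by (simp add: join_def)
    then show ?thesis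
      by (rule has_integral_eq[rotated]) (use True in \<open>auto simp: join_def\<close>)
  next
    case False
    then have "(join T ?V ?W has_integral (\<eta> T - \<eta> 0 + (\<zeta> (t - T) - \<zeta> 0))) {0..T + (t - T)}"
      using V[of T] W[of "t - T"] t T by (intro has_integral_join) auto
    then show ?thesis
      using False start eq by (simp add: join_def)
  qed
  moreover have "join T \<eta> \<zeta> ` {0..T + s} \<subseteq> sphere 0 1"
    using 1 2 by (fastforce simp: admissible_def join_def image_subset_iff)
  ultimately show "admissible a (T + s) (join T \<eta> \<zeta>) (join T u1 v1) (join T u2 v2)"
    using T u unfolding admissible_def velocity
    by (auto intro!: absolutely_integrable_on_join)
qed

lemma admissible_smooth:
  assumes "0 \<le> T" "\<And>t. t \<in> {0..T} \<Longrightarrow> \<eta> t \<in> sphere 0 1"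
    and "continuous_on {0..T} u1" "continuous_on {0..T} u2"
    and \<eta>': "\<And>t. t \<in> {0..T} \<Longrightarrow>
      (\<eta> has_vector_derivative \<eta> t \<times> omega a (u1 t) (u2 t)) (at t within {0..T})"
  shows "admissible a T \<eta> u1 u2"
proof -
  have "((\<lambda>s. \<eta> s \<times> omega a (u1 s) (u2 s)) has_integral (\<eta> t - \<eta> 0)) {0..t}"
    if "t \<in> {0..T}" for t
    using that by (intro fundamental_theorem_of_calculus)
      (auto intro: has_vector_derivative_within_subset[OF \<eta>'])
  then show ?thesis
    using assms by (auto simp: admissible_def intro!: absolutely_integrable_continuous_real)
qed

definition reflect :: "real^3 \<Rightarrow> real^3" where
  "reflect q = vector [q $ 1, q $ 2, - (q $ 3)]"

lemma reflect_components [simp]: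
  "reflect q $ 1 = q $ 1" "reflect q $ 2 = q $ 2" "reflect q $ 3 = - (q $ 3)"
  by (simp_all add: reflect_def)

lemma bounded_linear_reflect: "bounded_linear reflect"
  unfolding linear_conv_bounded_linear[symmetric]
  by (rule linearI) (auto simp: vec_eq_iff forall_3)

lemma norm_reflect [simp]: "norm (reflect q) = norm q"
  by (simp add: norm_vec_def L2_set_def sum_3)

lemma reflect_velocity: "reflect (q \<times> omega a v1 v2) = reflect q \<times> omega a (- v1) (- v2)"
  by (simp add: vec_eq_iff forall_3 cross_components omega_def axis_def)

text \<open>
The reflection in the plane of the equator reverses orientation, hence the cross product,
but fixes the horizontal axes of rotation. So it preserves admissibility and length once the
controls are negated.
\<close>

lemma admissible_reflect:
  assumes "admissible a T \<eta> u1 u2"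
  shows "admissible a T (\<lambda>t. reflect (\<eta> t)) (\<lambda>t. - u1 t) (\<lambda>t. - u2 t)"
proof -
  have "((\<lambda>s. reflect (\<eta> s) \<times> omega a (- u1 s) (- u2 s)) has_integral
      (reflect (\<eta> t) - reflect (\<eta> 0))) {0..t}" if "t \<in> {0..T}" for t
  proof -
    have "((\<lambda>s. \<eta> s \<times> omega a (u1 s) (u2 s)) has_integral (\<eta> t - \<eta> 0)) {0..t}"
      using assms that by (simp add: admissible_def)
    from has_integral_linear[OF this bounded_linear_reflect] show ?thesis
      by (simp add: o_def reflect_velocity
          linear_diff[OF bounded_linear.linear[OF bounded_linear_reflect]])
  qed
  moreover have "(\<lambda>t. - u1 t) absolutely_integrable_on {0..T}"
    "(\<lambda>t. - u2 t) absolutely_integrable_on {0..T}"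
    using assms absolutely_integrable_scaleR_left[where f = u1 and S = "{0..T}" and c = "- 1"]
      absolutely_integrable_scaleR_left[where f = u2 and S = "{0..T}" and c = "- 1"]
    by (simp_all add: admissible_def)
  ultimately show ?thesis
    using assms by (auto simp: admissible_def)
qed

text \<open>
The vectors \<open>e\<close> and \<open>e \<times> n\<close> are an orthogonal basis of the plane perpendicular to \<open>n\<close>, and
both have the same norm.
\<close>

lemma orthogonal_frame_expansion:
  fixes n e u :: "real^3"
  assumes n: "n \<bullet> n = 1" and e: "n \<bullet> e = 0" and u: "n \<bullet> u = 0"
  shows "(u \<bullet> e) *\<^sub>R e + (u \<bullet> (e \<times> n)) *\<^sub>R (e \<times> n) = (e \<bullet> e) *\<^sub>R u"
proof -
  have n': "n$1 * n$1 + n$2 * n$2 + n$3 * n$3 = 1" and e': "n$1 * e$1 + n$2 * e$2 + n$3 * e$3 = 0"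
    and u': "n$1 * u$1 + n$2 * u$2 + n$3 * u$3 = 0"
    using assms by (simp_all add: inner_vec_def sum_3)
  show ?thesis
    apply (simp add: vec_eq_iff forall_3 inner_vec_def sum_3 cross_components)
    apply (intro conjI)
    using n' e' u' by algebra+
qed

text \<open>
A constant control moves points by a rotation about a horizontal axis. Such a rotation takes
\<open>A\<close> to \<open>B\<close> when its axis is perpendicular to the horizontal part of \<open>B - A\<close>. Its length is comparable
to the angle, and the angle is at most of the order of \<open>norm (B - A)\<close> over the distance of \<open>A\<close> from the
axis. That distance is at least the height of \<open>A\<close> above the equator, so the
cost grows near the singular set no faster than the reciprocal of the height.
\<close>

lemma short_rotation:
  assumes a: "0 < a" "a < 1" and A: "A \<in> sphere 0 1" and B: "B \<in> sphere 0 1"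
    and "A $ 3 \<noteq> 0" and close: "norm (B - A) \<le> \<bar>A $ 3\<bar>"
  obtains \<eta> u1 u2 where "admissible a 1 \<eta> u1 u2" "\<eta> 0 = A" "\<eta> 1 = B"
    "curve_length 1 u1 u2 \<le> 2 * norm (B - A) / (sqrt (1 - a\<^sup>2) * \<bar>A $ 3\<bar>)"
proof -
  define b where "b = sqrt (1 - a\<^sup>2)"
  have "a\<^sup>2 < 1" using a by (simp add: power_less_one_iff)
  then have b: "0 < b" "b \<le> 1" by (simp_all add: b_def)
  have "\<exists>n1 n2. n1\<^sup>2 + n2\<^sup>2 = 1 \<and> n1 * (B - A) $ 1 + n2 * (B - A) $ 2 = 0"
  proof (cases "(B - A) $ 1 = 0 \<and> (B - A) $ 2 = 0")
    case True
    then show ?thesis by - (rule exI[of _ 1], rule exI[of _ 0], simp)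
  next
    case False
    define s where "s = sqrt (((B - A) $ 1)\<^sup>2 + ((B - A) $ 2)\<^sup>2)"
    have s2: "s\<^sup>2 = ((B - A) $ 1)\<^sup>2 + ((B - A) $ 2)\<^sup>2"
      by (simp add: s_def)
    have "s\<^sup>2 \<noteq> 0"
      unfolding s2 using False by (simp add: sum_power2_eq_zero_iff)
    then show ?thesis
      by - (rule exI[of _ "- ((B - A) $ 2) / s"], rule exI[of _ "(B - A) $ 1 / s"],
         simp add: power_divide add_divide_distrib[symmetric] s2 power2_commute[of "A $ 2"] algebra_simps)
  qed
  then obtain n1 n2 where n12: "n1\<^sup>2 + n2\<^sup>2 = 1" "n1 * (B - A) $ 1 + n2 * (B - A) $ 2 = 0"
    by blast
  define n :: "real^3" where "n = vector [n1, n2, 0]"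
  have n: "n \<bullet> n = 1"
    using n12(1) by (simp add: n_def inner_vec_def sum_3 power2_eq_square)
  define \<kappa> where "\<kappa> = n \<bullet> A"
  have \<kappa>B: "n \<bullet> B = \<kappa>"
    using n12(2) by (simp add: \<kappa>_def n_def inner_vec_def sum_3 algebra_simps)
  \<comment> \<open>components perpendicular to the axis; the circle of rotation has radius \<open>sqrt \<rho>\<close>\<close>
  define e u \<rho> where "e = A - \<kappa> *\<^sub>R n" and "u = B - \<kappa> *\<^sub>R n" and "\<rho> = 1 - \<kappa>\<^sup>2"
  have AA: "A \<bullet> A = 1" and BB: "B \<bullet> B = 1"
    using A B by (simp_all add: dot_square_norm)
  have ne: "n \<bullet> e = 0" and nu: "n \<bullet> u = 0" and ee: "e \<bullet> e = \<rho>" and uu: "u \<bullet> u = \<rho>"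
    using n \<kappa>B AA BB
    by (simp_all add: e_def u_def \<rho>_def \<kappa>_def[symmetric] inner_diff_left inner_diff_right
        inner_commute[of A n] inner_commute[of B n] power2_eq_square)
  have "\<bar>A $ 3\<bar>\<^sup>2 \<le> \<rho>"
  proof -
    have "(A$1)\<^sup>2 + (A$2)\<^sup>2 + (A$3)\<^sup>2 = 1"
      using AA by (simp add: inner_vec_def sum_3 power2_eq_square)
    moreover have "\<kappa>\<^sup>2 + (n1 * A$2 - n2 * A$1)\<^sup>2 = (A$1)\<^sup>2 + (A$2)\<^sup>2"
    proof -
      have "\<kappa> = n1 * A$1 + n2 * A$2" by (simp add: \<kappa>_def n_def inner_vec_def sum_3)
      then show ?thesis using n12(1) by algebra
    qed
    moreover have "(n1 * A$2 - n2 * A$1)\<^sup>2 \<ge> 0" by simp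
    ultimately show ?thesis unfolding \<rho>_def power2_abs by linarith
  qed
  then have A3: "\<bar>A $ 3\<bar> \<le> sqrt \<rho>" by (rule real_le_rsqrt)
  moreover have "\<bar>A $ 3\<bar> > 0" using \<open>A $ 3 \<noteq> 0\<close> by simp
  ultimately have \<rho>: "\<rho> > 0" by (metis less_le_trans real_sqrt_gt_0_iff)
  define f where "f = e \<times> n"
  have ef: "e \<bullet> f = 0" "n \<bullet> f = 0"
    by (simp_all add: f_def dot_cross_self)
  have ff: "f \<bullet> f = \<rho>"
    using ne n ee by (simp add: f_def dot_cross inner_commute)
  have fn: "f \<times> n = - e"
    using n ne by (simp add: f_def Lagrange inner_commute cross_skew[of "e \<times> n"])
  define C S where "C = (u \<bullet> e) / \<rho>" and "S = (u \<bullet> f) / \<rho>"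
  have u: "u = C *\<^sub>R e + S *\<^sub>R f"
  proof -
    have "\<rho> *\<^sub>R u = \<rho> *\<^sub>R (C *\<^sub>R e + S *\<^sub>R f)"
      using orthogonal_frame_expansion[OF n ne nu] \<rho> ee
      by (simp add: f_def C_def S_def scaleR_add_right)
    then show ?thesis using \<rho> by simp
  qed
  have "\<rho> = (C\<^sup>2 + S\<^sup>2) * \<rho>"
    using uu ee ef ff unfolding u
    by (simp add: inner_add_left inner_add_right inner_commute[of f e] power2_eq_square algebra_simps)
  then have CS: "C\<^sup>2 + S\<^sup>2 = 1" using \<rho> by simp
  have due: "u - e = B - A" by (simp add: u_def e_def)
  \<comment> \<open>closeness of \<open>A\<close> and \<open>B\<close> keeps the angle away from \<open>pi / 2\<close>, so that it is
    bounded by its tangent and then by twice its sine\<close>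
  have C: "C \<ge> 1 / 2"
  proof -
    have "(norm (B - A))\<^sup>2 \<le> (sqrt \<rho>)\<^sup>2"
      using close A3 by (intro power_mono) auto
    then have "(u - e) \<bullet> (u - e) \<le> \<rho>"
      using \<rho> by (simp add: due dot_square_norm)
    then have "u \<bullet> e \<ge> \<rho> / 2"
      using uu ee by (simp add: inner_diff_left inner_diff_right inner_commute[of e u])
    then show ?thesis using \<rho> by (simp add: C_def field_simps)
  qed
  have S: "\<bar>S\<bar> \<le> norm (B - A) / sqrt \<rho>"
  proof -
    have "\<bar>u \<bullet> f\<bar> = \<bar>(u - e) \<bullet> f\<bar>" using ef by (simp add: inner_diff_left)
    also have "\<dots> \<le> norm (B - A) * norm f"
      unfolding due by (rule Cauchy_Schwarz_ineq2)
    also have "norm f = sqrt \<rho>" using ff by (simp add: norm_eq_sqrt_inner)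
    finally have "\<bar>S\<bar> \<le> norm (B - A) * sqrt \<rho> / \<rho>"
      using \<rho> by (simp add: S_def abs_divide divide_right_mono)
    also have "\<dots> = norm (B - A) / sqrt \<rho>"
      using \<rho> sqrt_divide_self_eq[of \<rho>] by (simp add: divide_inverse mult.assoc)
    finally show ?thesis .
  qed
  have "\<bar>S\<bar> \<le> 1" using CS zero_le_power2[of C] by (simp only: abs_square_le_1[symmetric])
  define \<theta> where "\<theta> = arcsin S"
  have sin\<theta>: "sin \<theta> = S" using \<open>\<bar>S\<bar> \<le> 1\<close> by (simp add: \<theta>_def abs_le_iff)
  have "1 - S\<^sup>2 = C\<^sup>2" using CS by simp
  then have cos\<theta>: "cos \<theta> = C"
    using \<open>\<bar>S\<bar> \<le> 1\<close> C by (simp add: \<theta>_def abs_le_iff cos_arcsin)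
  have \<theta>: "\<bar>\<theta>\<bar> \<le> 2 * \<bar>S\<bar>"
  proof -
    have "\<bar>\<theta>\<bar> \<le> pi / 2"
      using \<open>\<bar>S\<bar> \<le> 1\<close> arcsin_bounded[of S] by (auto simp: \<theta>_def abs_le_iff)
    moreover have "\<bar>\<theta>\<bar> \<noteq> pi / 2" using cos\<theta> C by (metis cos_abs_real cos_pi_half less_le_not_le half_gt_zero zero_less_one)
    ultimately have "\<bar>\<theta>\<bar> \<le> \<bar>tan \<theta>\<bar>" by (intro abs_tan_ge) auto
    also have "\<bar>tan \<theta>\<bar> = \<bar>S\<bar> / C" using C by (simp add: tan_def sin\<theta> cos\<theta>)
    also have "\<dots> \<le> \<bar>S\<bar> / (1 / 2)" using C by (intro divide_left_mono) auto
    finally show ?thesis by simp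
  qed
  define \<eta> where "\<eta> s = \<kappa> *\<^sub>R n + cos (\<theta> * s) *\<^sub>R e + sin (\<theta> * s) *\<^sub>R f" for s
  \<comment> \<open>the constant controls whose angular velocity is \<open>\<theta> n\<close>\<close>
  define u1 u2 where "u1 = \<theta> * n2" and "u2 = \<theta> * n1 / b"
  have \<omega>: "omega a u1 u2 = \<theta> *\<^sub>R n"
    using b by (simp add: omega_def u1_def u2_def n_def b_def vec_eq_iff forall_3 axis_def)
  have "admissible a 1 \<eta> (\<lambda>_. u1) (\<lambda>_. u2)"
  proof (rule admissible_smooth)
    fix s :: real
    have "\<eta> s \<bullet> \<eta> s = \<kappa>\<^sup>2 + ((cos (\<theta> * s))\<^sup>2 + (sin (\<theta> * s))\<^sup>2) * \<rho>"
      by (simp only: \<eta>_def inner_add_left inner_add_right inner_scaleR_left inner_scaleR_right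
          inner_commute[of e n] inner_commute[of f n] inner_commute[of f e] n ne ef ee ff
          power2_eq_square ring_distribs mult_zero_right add_0_left add_0_right mult_1_right
          mult.assoc add.assoc)
    then have "\<eta> s \<bullet> \<eta> s = 1"
      by (simp add: \<rho>_def)
    then show "\<eta> s \<in> sphere 0 1" by (simp add: norm_eq_sqrt_inner)
    have "\<eta> s \<times> omega a u1 u2 = (- \<theta> * sin (\<theta> * s)) *\<^sub>R e + (\<theta> * cos (\<theta> * s)) *\<^sub>R f"
      using fn unfolding \<omega> \<eta>_def
      by (simp add: cross_add_left cross_mult_left cross_mult_right f_def[symmetric] algebra_simps)
    moreover have "(\<eta> has_vector_derivative
        (- \<theta> * sin (\<theta> * s)) *\<^sub>R e + (\<theta> * cos (\<theta> * s)) *\<^sub>R f) (at s within {0..1})"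
      unfolding \<eta>_def
      by (auto intro!: derivative_eq_intros simp: algebra_simps)
    ultimately show "(\<eta> has_vector_derivative \<eta> s \<times> omega a u1 u2) (at s within {0..1})" by simp
  qed auto
  moreover have "\<eta> 0 = A" by (simp add: \<eta>_def e_def)
  moreover have "\<eta> 1 = B"
    using u by (simp add: \<eta>_def cos\<theta> sin\<theta> u_def algebra_simps)
  moreover have "curve_length 1 (\<lambda>_. u1) (\<lambda>_. u2)
      \<le> 2 * norm (B - A) / (sqrt (1 - a\<^sup>2) * \<bar>A $ 3\<bar>)"
  proof -
    have "u1\<^sup>2 \<le> (\<theta> * n2 / b)\<^sup>2"
    proof -
      have "(\<theta> * n2)\<^sup>2 * b\<^sup>2 \<le> (\<theta> * n2)\<^sup>2 * 1"
        using b by (intro mult_left_mono) (auto simp: power_le_one)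
      then show ?thesis using b by (simp add: u1_def power_divide pos_le_divide_eq)
    qed
    then have "u1\<^sup>2 + u2\<^sup>2 \<le> (\<theta> * n2 / b)\<^sup>2 + u2\<^sup>2" by simp
    also have "\<dots> = (\<theta> / b)\<^sup>2 * (n1\<^sup>2 + n2\<^sup>2)"
      by (simp add: u2_def power_divide power_mult_distrib algebra_simps add_divide_distrib)
    finally have "u1\<^sup>2 + u2\<^sup>2 \<le> (\<theta> / b)\<^sup>2" using n12 by simp
    then have "sqrt (u1\<^sup>2 + u2\<^sup>2) \<le> \<bar>\<theta> / b\<bar>"
      by (metis real_sqrt_abs real_sqrt_le_iff)
    also have "\<dots> \<le> 2 * \<bar>S\<bar> / b"
      using \<theta> b by (simp add: abs_divide divide_right_mono)
    also have "\<dots> \<le> 2 * (norm (B - A) / \<bar>A $ 3\<bar>) / b"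
    proof -
      have "norm (B - A) / sqrt \<rho> \<le> norm (B - A) / \<bar>A $ 3\<bar>"
        using A3 \<open>\<bar>A $ 3\<bar> > 0\<close> \<rho> by (intro divide_left_mono mult_pos_pos) auto
      then show ?thesis
        using S b by (intro divide_right_mono mult_left_mono) auto
    qed
    finally show ?thesis by (simp add: curve_length_def b_def mult.commute)
  qed
  ultimately show thesis by (rule that)
qed

section \<open>Loss of minimality at the singular set\<close>

text \<open>
A second-order Taylor estimate in the form that needs the second derivative only at the point itself.
\<close>

lemma symmetric_quotient_tendsto_0:
  fixes F F' :: "real \<Rightarrow> real"
  assumes "\<delta> > 0" and F: "\<And>h. \<bar>h\<bar> < \<delta> \<Longrightarrow> (F has_real_derivative F' h) (at h)"
    and "F 0 = 0" "F' 0 = 0" and F': "(F' has_real_derivative 0) (at 0)"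
  shows "((\<lambda>h. F h / h\<^sup>2) \<longlongrightarrow> 0) (at_right 0)"
proof (rule lhopital_right_0[where f' = F' and g' = "\<lambda>h. 2 * h"])
  have "isCont F 0" using F[of 0] \<open>\<delta> > 0\<close> by (auto intro: DERIV_isCont)
  then show "(F \<longlongrightarrow> 0) (at_right 0)"
    using \<open>F 0 = 0\<close> by (simp add: isCont_def filterlim_at_split)
  show "((\<lambda>h::real. h\<^sup>2) \<longlongrightarrow> 0) (at_right 0)" by (auto intro!: tendsto_eq_intros)
  show "\<forall>\<^sub>F h in at_right 0. (F has_real_derivative F' h) (at h)"
    using F eventually_at_right_less[of "0::real"] \<open>\<delta> > 0\<close>
    by (auto simp: eventually_at_right_field intro!: exI[of _ \<delta>])
  show "\<forall>\<^sub>F h::real in at_right 0. h\<^sup>2 \<noteq> 0" "\<forall>\<^sub>F h::real in at_right 0. 2 * h \<noteq> 0"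
    using eventually_at_right_less[of "0::real"] by (auto elim!: eventually_mono)
  show "\<forall>\<^sub>F h::real in at_right 0. ((\<lambda>h. h\<^sup>2) has_real_derivative 2 * h) (at h)"
    by (auto intro!: derivative_eq_intros always_eventually)
  have "((\<lambda>h. F' h / h) \<longlongrightarrow> 0) (at 0)"
    using F' \<open>F' 0 = 0\<close> by (simp add: DERIV_def)
  then have "((\<lambda>h. F' h / h / 2) \<longlongrightarrow> 0 / 2) (at_right 0)"
    by (intro tendsto_intros) (auto simp: filterlim_at_split)
  then show "((\<lambda>h. F' h / (2 * h)) \<longlongrightarrow> 0) (at_right 0)"
    by (simp add: mult.commute)
qed

context geodesic
begin

lemma derivatives_at:
  assumes "t > 0"
  shows "(\<gamma>1 has_real_derivative - \<gamma>3 t * p1 t) (at t)"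
    and "(\<gamma>2 has_real_derivative b * \<gamma>3 t * p2 t) (at t)"
    and "(\<gamma>3 has_real_derivative \<gamma>3' t) (at t)"
    and "(p1 has_real_derivative p3 t * p2 t) (at t)"
    and "(p2 has_real_derivative - p3 t * p1 t) (at t)"
    and "(\<gamma>3' has_real_derivative - stiffness t * \<gamma>3 t) (at t)"
proof -
  have "at t within {0..} = at t"
    using assms by (intro at_within_interior) auto
  then show "(\<gamma>1 has_real_derivative - \<gamma>3 t * p1 t) (at t)"
    "(\<gamma>2 has_real_derivative b * \<gamma>3 t * p2 t) (at t)"
    "(\<gamma>3 has_real_derivative \<gamma>3' t) (at t)"
    "(p1 has_real_derivative p3 t * p2 t) (at t)"
    "(p2 has_real_derivative - p3 t * p1 t) (at t)"
    "(\<gamma>3' has_real_derivative - stiffness t * \<gamma>3 t) (at t)"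
    using geodesic_derivatives[of t] height_equation[of t] assms by simp_all
qed

text \<open>
Where the geodesic meets the equator, the departing curve and the time reversal of the
reflected arriving curve agree to second order: the velocity is vertical there, the vertical
acceleration vanishes, and neither reflection nor time reversal changes the horizontal
acceleration.
\<close>

lemma reflected_gap:
  assumes "\<tau> > 0" "\<gamma>3 \<tau> = 0"
  shows "((\<lambda>h. norm (\<gamma> (\<tau> + h) - reflect (\<gamma> (\<tau> - h))) / h\<^sup>2) \<longlongrightarrow> 0) (at_right 0)"
proof -
  have shift: "((\<lambda>h. f (\<tau> + h)) has_real_derivative f') (at h)"
    if "(f has_real_derivative f') (at (\<tau> + h))" for f f' h
    using DERIV_chain2[of f f' "\<lambda>h. \<tau> + h", OF that, of 1 UNIV]
      DERIV_add[OF DERIV_const DERIV_ident, of \<tau> h UNIV] by simp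
  have flip: "((\<lambda>h. f (\<tau> - h)) has_real_derivative - f') (at h)"
    if "(f has_real_derivative f') (at (\<tau> - h))" for f f' h
    using DERIV_chain2[of f f' "\<lambda>h. \<tau> - h", OF that, of "- 1" UNIV]
      DERIV_diff[OF DERIV_const DERIV_ident, of \<tau> h UNIV] by simp
  note shifts = derivatives_at[of "\<tau> + h" for h, THEN shift]
  note flips = derivatives_at[of "\<tau> - h" for h, THEN flip]
  have 1: "((\<lambda>h. (\<gamma>1 (\<tau> + h) - \<gamma>1 (\<tau> - h)) / h\<^sup>2) \<longlongrightarrow> 0) (at_right 0)"
    by (rule symmetric_quotient_tendsto_0[OF \<open>\<tau> > 0\<close>, where
          F' = "\<lambda>h. - \<gamma>3 (\<tau> + h) * p1 (\<tau> + h) - \<gamma>3 (\<tau> - h) * p1 (\<tau> - h)"])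
       (use assms in \<open>(auto intro!: derivative_eq_intros shifts flips, simp add: algebra_simps)\<close>)
  have 2: "((\<lambda>h. (\<gamma>2 (\<tau> + h) - \<gamma>2 (\<tau> - h)) / h\<^sup>2) \<longlongrightarrow> 0) (at_right 0)"
    by (rule symmetric_quotient_tendsto_0[OF \<open>\<tau> > 0\<close>, where
          F' = "\<lambda>h. b * \<gamma>3 (\<tau> + h) * p2 (\<tau> + h) + b * \<gamma>3 (\<tau> - h) * p2 (\<tau> - h)"])
       (use assms in \<open>(auto intro!: derivative_eq_intros shifts flips, simp add: algebra_simps)\<close>)
  have 3: "((\<lambda>h. (\<gamma>3 (\<tau> + h) + \<gamma>3 (\<tau> - h)) / h\<^sup>2) \<longlongrightarrow> 0) (at_right 0)"
  proof (rule symmetric_quotient_tendsto_0[OF \<open>\<tau> > 0\<close>, where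
        F' = "\<lambda>h. \<gamma>3' (\<tau> + h) - \<gamma>3' (\<tau> - h)"])
    fix h :: real assume "\<bar>h\<bar> < \<tau>"
    then have "0 < \<tau> + h" "0 < \<tau> - h" by auto
    from DERIV_add[OF shifts(3)[OF this(1)] flips(3)[OF this(2)]]
    show "((\<lambda>h. \<gamma>3 (\<tau> + h) + \<gamma>3 (\<tau> - h)) has_real_derivative
        \<gamma>3' (\<tau> + h) - \<gamma>3' (\<tau> - h)) (at h)"
      by (simp only: diff_conv_add_uminus)
  next
    show "((\<lambda>h. \<gamma>3' (\<tau> + h) - \<gamma>3' (\<tau> - h)) has_real_derivative 0) (at 0)"
      using DERIV_diff[OF shifts(6)[of 0] flips(6)[of 0]] assms by simp
  qed (use assms in auto)
  let ?d = "\<lambda>h. \<gamma> (\<tau> + h) - reflect (\<gamma> (\<tau> - h))"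
  have "((\<lambda>h. \<bar>?d h $ 1 / h\<^sup>2\<bar> + \<bar>?d h $ 2 / h\<^sup>2\<bar> + \<bar>?d h $ 3 / h\<^sup>2\<bar>) \<longlongrightarrow> 0 + 0 + 0) (at_right 0)"
    using 1 2 3 by (intro tendsto_add tendsto_rabs_zero) auto
  moreover have "norm d / h\<^sup>2 \<le> \<bar>d $ 1 / h\<^sup>2\<bar> + \<bar>d $ 2 / h\<^sup>2\<bar> + \<bar>d $ 3 / h\<^sup>2\<bar>" for d :: "real^3" and h
  proof -
    have "norm d / h\<^sup>2 \<le> (\<Sum>i\<in>UNIV. \<bar>d $ i\<bar>) / h\<^sup>2"
      by (intro divide_right_mono norm_le_l1_cart) auto
    then show ?thesis by (simp add: sum_3 add_divide_distrib abs_divide)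
  qed
  then have "norm (norm (?d h) / h\<^sup>2) \<le>
      norm (\<bar>?d h $ 1 / h\<^sup>2\<bar> + \<bar>?d h $ 2 / h\<^sup>2\<bar> + \<bar>?d h $ 3 / h\<^sup>2\<bar>) * 1" for h
    by (smt (verit, best) mult.right_neutral norm_ge_zero real_norm_def zero_le_divide_iff zero_le_power2)
  ultimately show ?thesis
    unfolding add_0_right by (rule tendsto_0_le[OF _ always_eventually[OF allI]])
qed

lemma arclength:
  assumes "0 \<le> s" "s \<le> t"
  shows "admissible a (t - s) (\<lambda>r. \<gamma> (s + r)) (\<lambda>r. p1 (s + r)) (\<lambda>r. p2 (s + r))"
    and "curve_length (t - s) (\<lambda>r. p1 (s + r)) (\<lambda>r. p2 (s + r)) = t - s"
proof -
  show "admissible a (t - s) (\<lambda>r. \<gamma> (s + r)) (\<lambda>r. p1 (s + r)) (\<lambda>r. p2 (s + r))"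
  proof (rule admissible_smooth)
    show "continuous_on {0..t - s} (\<lambda>r. p1 (s + r))"
      by (rule continuous_on_compose2[OF geodesic_continuous(1)])
         (use assms in \<open>auto intro!: continuous_intros\<close>)
    show "continuous_on {0..t - s} (\<lambda>r. p2 (s + r))"
      by (rule continuous_on_compose2[OF geodesic_continuous(2)])
         (use assms in \<open>auto intro!: continuous_intros\<close>)
    fix r assume r: "r \<in> {0..t - s}"
    show "\<gamma> (s + r) \<in> sphere 0 1" using in_sphere r assms by simp
    have "(\<gamma> has_vector_derivative \<gamma> (s + r) \<times> omega a (p1 (s + r)) (p2 (s + r)))
        (at (s + r) within (+) s ` {0..t - s})"
      using r assms
      by (intro has_vector_derivative_within_subset[OF geodesic_vector_derivative]) auto
    moreover have "((+) s has_vector_derivative 1) (at r within {0..t - s})"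
      by (auto intro!: derivative_eq_intros)
    ultimately show "((\<lambda>r. \<gamma> (s + r)) has_vector_derivative
        \<gamma> (s + r) \<times> omega a (p1 (s + r)) (p2 (s + r))) (at r within {0..t - s})"
      using vector_diff_chain_within[of "(+) s" 1 r "{0..t - s}" \<gamma>] by (simp add: o_def)
  qed (use assms in auto)
  have "curve_length (t - s) (\<lambda>r. p1 (s + r)) (\<lambda>r. p2 (s + r)) = integral {0..t - s} (\<lambda>_. 1)"
    unfolding curve_length_def using assms by (intro integral_cong) (auto simp: covector_norm)
  then show "curve_length (t - s) (\<lambda>r. p1 (s + r)) (\<lambda>r. p2 (s + r)) = t - s"
    using assms by simp
qed

text \<open>
The reflected geodesic on \<open>[0, \<tau>]\<close> followed by the original one is as long as the geodesic
and has the same endpoints, but it turns back on itself at the equator: within time \<open>h\<close> of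
\<open>\<tau>\<close> it passes through two points at height of order \<open>h\<close> whose distance is \<open>o(h\<^sup>2)\<close>. A
rotation joins them at cost \<open>o(h)\<close>, replacing a piece of length \<open>2 h\<close>, so the geodesic is not
minimizing.
\<close>

lemma not_minimizing_after_return:
  assumes "\<gamma>3 0 = 0" "0 < \<tau>" "\<gamma>3 \<tau> = 0" "\<tau> < t"
  shows "\<not> length_minimizing a t \<gamma> p1 p2"
proof
  assume min: "length_minimizing a t \<gamma> p1 p2"
  define v where "v = \<bar>\<gamma>3' \<tau>\<bar>"
  have "v > 0" using height_slope_nonzero[of \<tau>] assms by (simp add: v_def)
  have "((\<lambda>h. \<gamma>3 (\<tau> + h) / h) \<longlongrightarrow> \<gamma>3' \<tau>) (at 0)"
    using derivatives_at(3)[of \<tau>] assms by (simp add: DERIV_def)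
  then have "((\<lambda>h. \<gamma>3 (\<tau> + - h) / - h) \<longlongrightarrow> \<gamma>3' \<tau>) (at_right 0)"
    by (rule filterlim_compose)
       (auto simp: filterlim_at intro!: tendsto_eq_intros eventually_mono[OF eventually_at_right_less])
  then have "((\<lambda>h. \<bar>\<gamma>3 (\<tau> + - h) / - h\<bar>) \<longlongrightarrow> v) (at_right 0)"
    unfolding v_def by (rule tendsto_rabs)
  then have "\<forall>\<^sub>F h in at_right 0. \<bar>\<gamma>3 (\<tau> + - h) / - h\<bar> > v / 2"
    using \<open>v > 0\<close> by (intro order_tendstoD) auto
  \<comment> \<open>with this constant, a gap below \<open>b v h\<^sup>2 / 2\<close> at height above \<open>v h / 2\<close> costs less than \<open>2 h\<close>\<close>
  moreover have "\<forall>\<^sub>F h in at_right 0. norm (\<gamma> (\<tau> + h) - reflect (\<gamma> (\<tau> - h))) / h\<^sup>2 < b * v / 2"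
    using reflected_gap[of \<tau>] \<open>v > 0\<close> b_pos assms by (intro order_tendstoD) auto
  moreover have "\<forall>\<^sub>F h in at_right 0. h < Min {1, \<tau>, t - \<tau>}"
    using assms by (intro eventually_at_rightI[of 0 "Min {1, \<tau>, t - \<tau>}"]) auto
  moreover have "\<forall>\<^sub>F h::real in at_right 0. 0 < h" by (rule eventually_at_right_less)
  ultimately have "\<forall>\<^sub>F h in at_right 0. \<bar>\<gamma>3 (\<tau> + - h) / - h\<bar> > v / 2 \<and>
      norm (\<gamma> (\<tau> + h) - reflect (\<gamma> (\<tau> - h))) / h\<^sup>2 < b * v / 2 \<and>
      h < Min {1, \<tau>, t - \<tau>} \<and> 0 < h"
    by eventually_elim simp
  then obtain h where h: "\<bar>\<gamma>3 (\<tau> + - h) / - h\<bar> > v / 2"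
    "norm (\<gamma> (\<tau> + h) - reflect (\<gamma> (\<tau> - h))) / h\<^sup>2 < b * v / 2" "0 < h" "h < 1" "h < \<tau>" "h < t - \<tau>"
    using eventually_happens'[OF trivial_limit_at_right_real] by fastforce
  define A B where "A = reflect (\<gamma> (\<tau> - h))" and "B = \<gamma> (\<tau> + h)"
  have A3: "\<bar>A $ 3\<bar> > v / 2 * h"
    using h by (simp add: A_def abs_divide pos_less_divide_eq)
  have d: "norm (B - A) < b * v / 2 * h\<^sup>2"
    using h by (simp add: A_def B_def pos_divide_less_eq)
  have "v / 2 * h > 0" using \<open>v > 0\<close> h by simp
  have "b \<le> 1" using a2 by simp
  then have "b * h \<le> 1" using b_pos h by (intro mult_le_one) auto
  then have "v / 2 * h * (b * h) \<le> v / 2 * h"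
    using \<open>v / 2 * h > 0\<close> by (intro mult_right_le_one_le) (use b_pos h in auto)
  then have close: "norm (B - A) \<le> \<bar>A $ 3\<bar>"
    using A3 d by (simp add: power2_eq_square algebra_simps)
  have "A $ 3 \<noteq> 0" using A3 \<open>v / 2 * h > 0\<close> by auto
  have AB: "A \<in> sphere 0 1" "B \<in> sphere 0 1"
    using in_sphere[of "\<tau> - h"] in_sphere[of "\<tau> + h"] h assms by (auto simp: A_def B_def)
  obtain \<eta> u1 u2 where \<eta>: "admissible a 1 \<eta> u1 u2" "\<eta> 0 = A" "\<eta> 1 = B"
    "curve_length 1 u1 u2 \<le> 2 * norm (B - A) / (b * \<bar>A $ 3\<bar>)"
    using short_rotation[OF a_pos a_less_1 AB \<open>A $ 3 \<noteq> 0\<close> close] by blast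
  have "2 * norm (B - A) < 2 * h * (b * (v / 2 * h))"
    using d by (simp add: power2_eq_square algebra_simps)
  also have "\<dots> \<le> 2 * h * (b * \<bar>A $ 3\<bar>)"
    using A3 h b_pos by (intro mult_left_mono) auto
  finally have "2 * norm (B - A) / (b * \<bar>A $ 3\<bar>) < 2 * h"
    using b_pos \<open>A $ 3 \<noteq> 0\<close> by (simp add: pos_divide_less_eq)
  with \<eta>(4) have short: "curve_length 1 u1 u2 < 2 * h" by simp
  have start: "admissible a (\<tau> - h) (\<lambda>r. reflect (\<gamma> r)) (\<lambda>r. - p1 r) (\<lambda>r. - p2 r)"
    "curve_length (\<tau> - h) (\<lambda>r. - p1 r) (\<lambda>r. - p2 r) = \<tau> - h"
    using arclength[of 0 "\<tau> - h"] admissible_reflect[of a "\<tau> - h" \<gamma> p1 p2] h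
    by (simp_all add: curve_length_def)
  have "0 \<le> \<tau> + h" "\<tau> + h \<le> t" using h assms by auto
  note finish = arclength[OF this]
  have "reflect (\<gamma> (\<tau> - h)) = \<eta> 0" using \<eta> by (simp add: A_def)
  note first = admissible_join[OF start(1) \<eta>(1) this]
  have "join (\<tau> - h) (\<lambda>r. reflect (\<gamma> r)) \<eta> (\<tau> - h + 1) = \<gamma> (\<tau> + h + 0)"
    using first(4) \<eta> by (simp add: B_def)
  note whole = admissible_join[OF first(1) finish(1) this]
  have "reflect (\<gamma> 0) = \<gamma> 0"
    using assms by (simp add: vec_eq_iff forall_3)
  then have "curve_length t p1 p2 \<le> curve_length (\<tau> - h + 1 + (t - (\<tau> + h)))
      (join (\<tau> - h + 1) (join (\<tau> - h) (\<lambda>r. - p1 r) u1) (\<lambda>r. p1 (\<tau> + h + r)))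
      (join (\<tau> - h + 1) (join (\<tau> - h) (\<lambda>r. - p2 r) u2) (\<lambda>r. p2 (\<tau> + h + r)))"
    using min whole(1) whole(3)[unfolded first(3)] whole(4)
    by (simp add: length_minimizing_def)
  also have "\<dots> = (\<tau> - h) + curve_length 1 u1 u2 + (t - (\<tau> + h))"
    unfolding whole(2) first(2) start(2) finish(2) ..
  finally have "curve_length t p1 p2 \<le> (\<tau> - h) + curve_length 1 u1 u2 + (t - (\<tau> + h))" .
  moreover have "curve_length t p1 p2 = t"
    using arclength(2)[of 0 t] assms by simp
  ultimately show False using short by simp
qed

lemma cut_time_le_return:
  assumes "\<gamma>3 0 = 0" "\<exists>\<tau>. 0 < \<tau> \<and> \<tau> \<le> T \<and> \<gamma>3 \<tau> = 0"
  shows "cut_time a \<gamma> p \<le> ereal T"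
  unfolding cut_time_def
proof (rule Sup_least)
  fix e assume "e \<in> {ereal t | t. 0 < t \<and> length_minimizing a t \<gamma> p1 p2}"
  then obtain t where t: "e = ereal t" "length_minimizing a t \<gamma> p1 p2" by blast
  obtain \<tau> where "0 < \<tau>" "\<tau> \<le> T" "\<gamma>3 \<tau> = 0" using assms(2) by blast
  then have "t \<le> T"
    using not_minimizing_after_return[OF assms(1), of \<tau> t] t by (cases "\<tau> < t") auto
  then show "e \<le> ereal T" using t by simp
qed

end

section \<open>Cut time bounds\<close>

theorem corollary12:
  fixes a :: real and \<gamma> p :: "real \<Rightarrow> real^3"
  assumes "0 < a" and "a < 1"
    and "arclength_geodesic a \<gamma> p"
    and "\<gamma> 0 \<in> singular_set"
  shows
    "(p 0 \<in> C1 a \<longrightarrow> cut_time a \<gamma> p \<le> ereal (2 * elliptic_K ((modulus a (p 0))\<^sup>2) / a)) \<and>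
     (p 0 \<in> C2 a \<longrightarrow>
        cut_time a \<gamma> p \<le> ereal (2 * modulus a (p 0) * elliptic_K ((modulus a (p 0))\<^sup>2) / a)) \<and>
     (p 0 \<in> C3 a \<longrightarrow> cut_time a \<gamma> p \<le> ereal (pi / sqrt (1 - a\<^sup>2))) \<and>
     (p 0 \<in> C4 a \<longrightarrow> cut_time a \<gamma> p \<le> ereal pi) \<and>
     (p 0 \<in> C5 a \<longrightarrow> cut_time a \<gamma> p \<le> ereal (pi / sqrt (1 - a\<^sup>2)))"
proof -
  interpret geodesic a \<gamma> p
    using assms by unfold_locales
  have start: "\<gamma>3 0 = 0" using assms by (simp add: singular_set_def)
  have cyl: "p 0 \<in> cylinder" using covector_norm[of 0] by (simp add: cylinder_def)
  note energy = energy_eq_pendulum_energy[OF cyl]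
  have cont: "continuous_on {0..T} p1" "continuous_on {0..T} p3" for T
    using geodesic_continuous(1,3) by (auto elim!: continuous_on_subset)
  have deriv:
    "(p1 has_real_derivative p3 t * p2 t) (at t within {0..T})"
    "(p2 has_real_derivative - p3 t * p1 t) (at t within {0..T})"
    "(p3 has_real_derivative a\<^sup>2 * p1 t * p2 t) (at t within {0..T})" if "t \<in> {0..T}" for t T
    using that DERIV_subset[OF geodesic_derivatives(4), of t "{0..T}"]
      DERIV_subset[OF geodesic_derivatives(5), of t "{0..T}"]
      DERIV_subset[OF geodesic_derivatives(6), of t "{0..T}"] by simp_all
  have C1: "cut_time a \<gamma> p \<le> ereal (2 * elliptic_K ((modulus a (p 0))\<^sup>2) / a)" if "p 0 \<in> C1 a"
  proof -
    define k T where "k = modulus a (p 0)" and "T = 2 * elliptic_K (k\<^sup>2) / a"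
    have k: "0 < k" "k < 1" "k\<^sup>2 = pendulum_energy / a\<^sup>2"
      using modulus_C1[OF \<open>0 < a\<close> that] energy by (auto simp: k_def)
    have k2: "0 \<le> k\<^sup>2" "k\<^sup>2 < 1" using k(1,2) by (simp_all add: power_less_one_iff)
    have he: "pendulum_energy = a\<^sup>2 * k\<^sup>2" using k(3) \<open>0 < a\<close> by simp
    then have he_pos: "pendulum_energy > 0" using k(1) a2 by simp
    have "T > 0" using elliptic_K_pos[OF k2] \<open>0 < a\<close> by (simp add: T_def)
    have inv: "(p3 t)\<^sup>2 + a\<^sup>2 * (p2 t)\<^sup>2 = pendulum_energy" "(p1 t)\<^sup>2 + (p2 t)\<^sup>2 = 1" if "t \<in> {0..T}" for t
      using pendulum_energy_conserved covector_norm that by auto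
    \<comment> \<open>the pendulum oscillates, and \<open>(p2, p3 / a)\<close> rotates on a circle of radius \<open>k\<close>\<close>
    have x': "(p2 has_real_derivative (- a * p1 t) * (p3 t / a)) (at t within {0..T})"
      and y': "((\<lambda>t. p3 t / a) has_real_derivative - (- a * p1 t) * p2 t) (at t within {0..T})"
      if "t \<in> {0..T}" for t
      using deriv[OF that] DERIV_cdivide[OF deriv(3)[OF that], of a] \<open>0 < a\<close>
      by (simp_all add: power2_eq_square field_simps)
    have P: "continuous_on {0..T} (\<lambda>t. - a * p1 t)"
      by (intro continuous_intros cont)
    have P2: "(- a * p1 t)\<^sup>2 = a\<^sup>2 * (1 - k\<^sup>2 * (p2 t / k)\<^sup>2)" if "t \<in> {0..T}" for t
    proof -
      have "k\<^sup>2 * (p2 t / k)\<^sup>2 = (p2 t)\<^sup>2" using k(1) by (simp add: power_divide)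
      then show ?thesis using inv(2)[OF that] by algebra
    qed
    have r: "(p2 0)\<^sup>2 + (p3 0 / a)\<^sup>2 = k\<^sup>2"
      using inv(1)[of 0] \<open>T > 0\<close> he \<open>0 < a\<close> by (simp add: power_divide field_simps)
    note turn = rotation_half_turn[OF k2 \<open>0 < a\<close> k(1) T_def x' y' P P2 r]
    have "p1 T = p1 0" "p3 T = - p3 0"
      using turn \<open>0 < a\<close> by (simp_all add: field_simps)
    then have "\<exists>t. 0 < t \<and> t \<le> T \<and> \<gamma>3 t = 0"
      using turn(1) by (intro height_zero_half_period[OF \<open>T > 0\<close> start he_pos]) auto
    then show ?thesis
      using cut_time_le_return[OF start, of T] by (simp add: T_def k_def)
  qed
  have C2: "cut_time a \<gamma> p \<le> ereal (2 * modulus a (p 0) * elliptic_K ((modulus a (p 0))\<^sup>2) / a)"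
    if "p 0 \<in> C2 a"
  proof -
    define k C T where "k = modulus a (p 0)" and "C = a / k" and "T = 2 * elliptic_K (k\<^sup>2) / C"
    have he0: "pendulum_energy > a\<^sup>2" using that energy by (simp add: C2_def)
    then have he1: "pendulum_energy > 0" using a2(1) by (rule less_trans[rotated])
    have k: "0 < k" "k < 1" "k\<^sup>2 = a\<^sup>2 / pendulum_energy"
      using modulus_C2[OF \<open>0 < a\<close> that] energy by (auto simp: k_def)
    have k2: "0 \<le> k\<^sup>2" "k\<^sup>2 < 1" using k(1,2) by (simp_all add: power_less_one_iff)
    have C: "C > 0" "C\<^sup>2 = pendulum_energy" "pendulum_energy * k\<^sup>2 = a\<^sup>2"
      using k \<open>0 < a\<close> he1 by (auto simp: C_def power_divide)
    have "T > 0" using elliptic_K_pos[OF k2] C by (simp add: T_def)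
    have inv: "(p3 t)\<^sup>2 + a\<^sup>2 * (p2 t)\<^sup>2 = pendulum_energy" "(p1 t)\<^sup>2 + (p2 t)\<^sup>2 = 1" if "t \<in> {0..T}" for t
      using pendulum_energy_conserved covector_norm that by auto
    \<comment> \<open>the pendulum rotates, and so does the covector \<open>(p2, p1)\<close> on the unit circle\<close>
    have x': "(p2 has_real_derivative (- p3 t) * p1 t) (at t within {0..T})"
      and y': "(p1 has_real_derivative - (- p3 t) * p2 t) (at t within {0..T})"
      if "t \<in> {0..T}" for t
      using deriv[OF that] by simp_all
    have P: "continuous_on {0..T} (\<lambda>t. - p3 t)"
      by (intro continuous_intros cont)
    have P2: "(- p3 t)\<^sup>2 = C\<^sup>2 * (1 - k\<^sup>2 * (p2 t / 1)\<^sup>2)" if "t \<in> {0..T}" for t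
      using inv(1)[OF that]
      by (simp add: C(2) right_diff_distrib mult.assoc[symmetric] C(3))
    have r: "(p2 0)\<^sup>2 + (p1 0)\<^sup>2 = 1\<^sup>2"
      using inv(2)[of 0] \<open>T > 0\<close> by simp
    note turn = rotation_half_turn[OF k2 C(1) zero_less_one T_def x' y' P P2 r]
    have "\<exists>t. 0 < t \<and> t \<le> T \<and> \<gamma>3 t = 0"
      using turn by (intro height_zero_half_period[OF \<open>T > 0\<close> start he1]) auto
    moreover have "T = 2 * k * elliptic_K (k\<^sup>2) / a"
      using k by (simp add: T_def C_def)
    ultimately show ?thesis
      using cut_time_le_return[OF start, of T] by (simp add: k_def)
  qed
  have C35: "cut_time a \<gamma> p \<le> ereal (pi / b)" if "energy a (p 0) = a\<^sup>2"
  proof (intro cut_time_le_return[OF start] height_zero_constant_stiffness[OF start b_pos])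
    fix t :: real assume "t \<ge> 0"
    \<comment> \<open>here \<open>stiffness t = 1 + a\<^sup>2 - 2 a\<^sup>2 p2\<^sup>2\<close>\<close>
    have "(p2 t)\<^sup>2 \<le> 1"
      using covector_norm[OF \<open>t \<ge> 0\<close>] zero_le_power2[of "p1 t"] by linarith
    then have "a\<^sup>2 * (p2 t)\<^sup>2 \<le> a\<^sup>2 * 1" using a2 by (intro mult_left_mono) auto
    then show "b\<^sup>2 \<le> stiffness t"
      using that energy unfolding stiffness_def b2 by simp
  qed
  have C4: "cut_time a \<gamma> p \<le> ereal pi" if "energy a (p 0) = - a\<^sup>2"
  proof -
    have rest: "pendulum_energy = 0" using that energy by simp
    have "1\<^sup>2 \<le> stiffness t" if "t \<ge> 0" for t
    proof -
      have "a\<^sup>2 * (p2 t)\<^sup>2 \<le> 0"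
        using pendulum_energy_conserved[OF that] rest zero_le_power2[of "p3 t"] by linarith
      then show ?thesis by (simp add: stiffness_def rest)
    qed
    then show ?thesis
      using cut_time_le_return[OF start height_zero_constant_stiffness[OF start zero_less_one]]
      by simp
  qed
  show ?thesis
    using C1 C2 C35 C4 by (auto simp: C3_def C4_def C5_def)
qed

end
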